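(* Let $F\subset\mathbb{R}$ be any subset, let $n\ge 1$ be an integer and let $f:F\to\mathbb{R}$. Then $f$ is $n$-monotone if and only if for every integer $k$ with $1\le k\le n$, all pairwise distinct $x_0,x_1,\ldots,x_{2k-1}\in F$ and every real polynomial $q\in\mathbb{R}_{k-1}[x]$ one has $$[x_0,x_1,\ldots,x_{2k-1}]_{f q^2}\ge 0.$$ Moreover, if $F$ has more than $2n$ elements, it suffices to verify the case $k=n$: that is, in that case $f$ is $n$-monotone if and only if $[x_0,\ldots,x_{2n-1}]_{fq^2}\ge 0$ for all pairwise distinct $x_0,\ldots,x_{2n-1}\in F$ and all $q\in\mathbb{R}_{n-1}[x]$.
   Context: Matrices are ordered by the Loewner order: $A\le B$ iff $B-A$ is positive semidefinite. For $F\subset\mathbb{R}$, a function $f:F\to\mathbb{R}$ is $n$-monotone if for all $n\times n$ (complex) Hermitian matrices $A\le B$ whose spectra are both contained in $F$ one has $f(A)\le f(B)$, where $f(A)$ is obtained by applying $f$ to the eigenvalues of $A$ in a spectral decomposition. $\mathbb{R}_{m}[x]$ denotes the real polynomials of degree at most $m$. For pairwise distinct points $\lambda_0,\ldots,\lambda_m$, $[\lambda_0,\ldots,\lambda_m]_g=\sum_{i=0}^{m}\frac{g(\lambda_i)}{\prod_{j\ne i}(\lambda_i-\lambda_j)}$. $fq^2$ is the pointwise product on $F$. *)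

theory Defs
  imports "Jordan_Normal_Form.Spectral_Radius" "Jordan_Normal_Form.Schur_Decomposition"
begin

definition hermitian_mat :: "nat \<Rightarrow> complex mat \<Rightarrow> bool" where
  "hermitian_mat n A \<longleftrightarrow> A \<in> carrier_mat n n \<and> mat_adjoint A = A"

definition unitary_mat :: "nat \<Rightarrow> complex mat \<Rightarrow> bool" where
  "unitary_mat n U \<longleftrightarrow> U \<in> carrier_mat n n \<and> U * mat_adjoint U = 1\<^sub>m n \<and> mat_adjoint U * U = 1\<^sub>m n"

(* The order on complex used here is the one of HOL-Library.Complex_Order:
   0 \<le> z means that z is real and nonnegative. *)
definition psd_mat :: "nat \<Rightarrow> complex mat \<Rightarrow> bool" where
  "psd_mat n A \<longleftrightarrow> hermitian_mat n A \<and> (\<forall>v \<in> carrier_vec n. 0 \<le> (A *\<^sub>v v) \<bullet>c v)"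

definition loewner_le :: "nat \<Rightarrow> complex mat \<Rightarrow> complex mat \<Rightarrow> bool" where
  "loewner_le n A B \<longleftrightarrow> A \<in> carrier_mat n n \<and> B \<in> carrier_mat n n \<and> psd_mat n (B - A)"

definition spectral_decomp :: "complex mat \<Rightarrow> complex mat \<Rightarrow> (nat \<Rightarrow> real) \<Rightarrow> bool" where
  "spectral_decomp A U d \<longleftrightarrow> unitary_mat (dim_row A) U \<and>
     A = U * mat_diag (dim_row A) (\<lambda>i. complex_of_real (d i)) * mat_adjoint U"

(* By mat_fun_eq below the value does not depend on the chosen decomposition; it is
   meaningful for Hermitian A only. *)
definition mat_fun :: "(real \<Rightarrow> real) \<Rightarrow> complex mat \<Rightarrow> complex mat" where
  "mat_fun f A = (SOME C. \<exists>U d. spectral_decomp A U d \<and>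
     C = U * mat_diag (dim_row A) (\<lambda>i. complex_of_real (f (d i))) * mat_adjoint U)"

(* A function on F is represented by a total function f, of which only the values on F are used. *)
definition n_monotone_on :: "nat \<Rightarrow> real set \<Rightarrow> (real \<Rightarrow> real) \<Rightarrow> bool" where
  "n_monotone_on n F f \<longleftrightarrow> (\<forall>A B. hermitian_mat n A \<and> hermitian_mat n B \<and>
     spectrum A \<subseteq> complex_of_real ` F \<and> spectrum B \<subseteq> complex_of_real ` F \<and> loewner_le n A B
     \<longrightarrow> loewner_le n (mat_fun f A) (mat_fun f B))"

(* The divided difference of g at the m + 1 points x 0, ..., x m. *)
definition divided_diff :: "(nat \<Rightarrow> real) \<Rightarrow> nat \<Rightarrow> (real \<Rightarrow> real) \<Rightarrow> real" where
  "divided_diff x m g = (\<Sum>i\<le>m. g (x i) / (\<Prod>j\<in>{..m} - {i}. x i - x j))"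

lemma mat_adjoint_carrier: "U \<in> carrier_mat n m \<Longrightarrow> mat_adjoint U \<in> carrier_mat m n"
  unfolding mat_adjoint_def by (intro carrier_matI) simp_all

lemma mat_fun_eq_aux:
  assumes U: "spectral_decomp A U d" and V: "spectral_decomp A V e"
  shows "U * mat_diag (dim_row A) (\<lambda>i. complex_of_real (f (d i))) * mat_adjoint U =
         V * mat_diag (dim_row A) (\<lambda>i. complex_of_real (f (e i))) * mat_adjoint V"
proof -
  define n where "n = dim_row A"
  define U' where "U' = mat_adjoint U"
  define V' where "V' = mat_adjoint V"
  define W where "W = V' * U"
  define D where "D = mat_diag n (\<lambda>i. complex_of_real (d i))"
  define E where "E = mat_diag n (\<lambda>i. complex_of_real (e i))"
  define D' where "D' = mat_diag n (\<lambda>i. complex_of_real (f (d i)))"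
  define E' where "E' = mat_diag n (\<lambda>i. complex_of_real (f (e i)))"
  have Uc: "U \<in> carrier_mat n n" and UU: "U * U' = 1\<^sub>m n" "U' * U = 1\<^sub>m n"
    and Vc: "V \<in> carrier_mat n n" and VV: "V * V' = 1\<^sub>m n" "V' * V = 1\<^sub>m n"
    and A: "A = U * D * U'" "A = V * E * V'"
    using U V unfolding spectral_decomp_def unitary_mat_def n_def U'_def V'_def D_def E_def
    by blast+
  have c: "U' \<in> carrier_mat n n" "V' \<in> carrier_mat n n" "D \<in> carrier_mat n n"
    "E \<in> carrier_mat n n" "D' \<in> carrier_mat n n" "E' \<in> carrier_mat n n"
    using Uc Vc by (auto simp: U'_def V'_def D_def E_def D'_def E'_def mat_adjoint_carrier)
  have Wc: "W \<in> carrier_mat n n" using Uc c unfolding W_def by auto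
  note [simp] = Uc Vc c Wc mult_carrier_mat[of _ n n _ n]
  note as = assoc_mult_mat[of _ n n _ n _ n]
  have "V' * (U * D * U') * U = V' * (V * E * V') * U" using A by simp
  moreover have "V' * (U * D * U') * U = W * D * (U' * U)"
    unfolding W_def by (simp add: as)
  moreover have "V' * (V * E * V') * U = (V' * V) * E * W"
    unfolding W_def by (simp add: as)
  ultimately have "W * D * 1\<^sub>m n = 1\<^sub>m n * E * W"
    by (simp only: UU VV)
  hence eq: "W * D = E * W"
    by (simp add: right_mult_one_mat[of _ n n] left_mult_one_mat[of _ n n])
  have "W $$ (i,j) * complex_of_real (f (d j)) = complex_of_real (f (e i)) * W $$ (i,j)"
    if ij: "i < n" "j < n" for i j
  proof -
    have "(W * D) $$ (i,j) = (E * W) $$ (i,j)" using eq by simp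
    hence "W $$ (i,j) * complex_of_real (d j) = complex_of_real (e i) * W $$ (i,j)"
      unfolding D_def E_def mat_diag_mult_right[OF Wc] mat_diag_mult_left[OF Wc] using ij by simp
    hence "W $$ (i,j) = 0 \<or> d j = e i" by (metis mult.commute mult_cancel_left of_real_eq_iff)
    thus ?thesis by (elim disjE) (simp_all add: mult.commute)
  qed
  hence eq': "W * D' = E' * W"
    unfolding D'_def E'_def mat_diag_mult_right[OF Wc] mat_diag_mult_left[OF Wc] by (intro cong_mat refl) simp
  have "U * D' * U' = (V * V') * (U * D' * U')" by (simp add: VV left_mult_one_mat[of _ n n])
  also have "\<dots> = V * (W * D') * U'" unfolding W_def by (simp add: as)
  also have "\<dots> = V * E' * V' * (U * U')" unfolding eq' unfolding W_def by (simp add: as)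
  also have "\<dots> = V * E' * V'" by (simp add: UU right_mult_one_mat[of _ n n])
  finally show ?thesis unfolding D'_def E'_def U'_def V'_def n_def .
qed

lemma mat_fun_eq:
  assumes "spectral_decomp A U d"
  shows "mat_fun f A = U * mat_diag (dim_row A) (\<lambda>i. complex_of_real (f (d i))) * mat_adjoint U"
proof -
  let ?P = "\<lambda>C. \<exists>V e. spectral_decomp A V e \<and>
    C = V * mat_diag (dim_row A) (\<lambda>i. complex_of_real (f (e i))) * mat_adjoint V"
  have "?P (U * mat_diag (dim_row A) (\<lambda>i. complex_of_real (f (d i))) * mat_adjoint U)"
    by (intro exI conjI) (rule assms, rule refl)
  then have "?P (SOME C. ?P C)" by (rule someI[where P = ?P])
  then have "?P (mat_fun f A)" unfolding mat_fun_def .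
  then obtain V e where V: "spectral_decomp A V e"
    and eq: "mat_fun f A = V * mat_diag (dim_row A) (\<lambda>i. complex_of_real (f (e i))) * mat_adjoint V"
    by (elim exE conjE)
  show ?thesis unfolding eq by (rule mat_fun_eq_aux[OF V assms])
qed

end

theory Submission
  imports Defs
begin

text \<open>Sufficiency. Let \<open>A \<le> B\<close> and let \<open>S\<close> be the union of the spectra, \<open>m = card S \<le> 2 n\<close>. For a vector \<open>v\<close> the
  functional \<open>f \<mapsto> \<langle>(f(B) - f(A)) v, v\<rangle>\<close> is the divided difference \<open>[S]_{f N}\<close> for a polynomial \<open>N\<close> of degree at
  most \<open>m - 2\<close>, and \<open>N(t) / \<Prod>(t - s) = \<langle>((t - B)\<inverse> - (t - A)\<inverse>) v, v\<rangle>\<close> is nonnegative outside the convex hull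
  \<open>[a, b]\<close> of \<open>S\<close>, as inversion is antitone. Factoring \<open>N\<close> over the reals shows that it is a sum of terms \<open>q\<^sup>2\<close> and
  \<open>q\<^sup>2 (t - a) (t - b)\<close> if \<open>m\<close> is even, and of terms \<open>q\<^sup>2 (t - a)\<close> and \<open>q\<^sup>2 (t - b)\<close> if \<open>m\<close> is odd. A linear factor
  removes its root from the divided difference, so each term contributes \<open>[S']_{f q\<^sup>2} \<ge> 0\<close> with \<open>S' \<subseteq> S\<close>.

  Necessity. For sorted points, the even ones and the odd ones interlace, hence are the spectra of \<open>A\<close> and of a
  rank one perturbation \<open>B \<ge> A\<close>; a suitable \<open>v\<close> turns \<open>\<langle>(f(B) - f(A)) v, v\<rangle>\<close> into the given divided difference.\<close>

section \<open>Divided differences\<close>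

text \<open>A divided difference does not depend on the order of its nodes, so a set suffices, and
  dropping a node becomes a set difference.\<close>

definition dd :: "real set \<Rightarrow> (real \<Rightarrow> real) \<Rightarrow> real" where
  "dd S g = (\<Sum>s\<in>S. g s / (\<Prod>r\<in>S - {s}. s - r))"

lemma dd_image:
  assumes "inj_on x I"
  shows "dd (x ` I) g = (\<Sum>i\<in>I. g (x i) / (\<Prod>j\<in>I - {i}. x i - x j))"
proof -
  have "(\<Prod>j\<in>I - {i}. x i - x j) = (\<Prod>r\<in>x ` I - {x i}. x i - r)" if "i \<in> I" for i
  proof -
    have "x ` I - {x i} = x ` (I - {i})"
      using assms that by (auto simp: inj_on_def)
    then show ?thesis
      using assms by (simp add: prod.reindex inj_on_diff)
  qed
  then show ?thesis
    unfolding dd_def using assms by (simp add: sum.reindex)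
qed

lemma divided_diff_eq_dd:
  assumes "inj_on x {..m}"
  shows "divided_diff x m g = dd (x ` {..m}) g"
  unfolding dd_image[OF assms] divided_diff_def ..

text \<open>Serves two purposes: with one extra node it yields partial fractions, and with two
  interlacing node sets it separates the contributions of the two spectra.\<close>

lemma dd_Un_disjoint:
  assumes "finite S" "finite T" "S \<inter> T = {}"
  shows "dd (S \<union> T) g =
    (\<Sum>s\<in>S. g s / ((\<Prod>r\<in>S - {s}. s - r) * (\<Prod>r\<in>T. s - r))) +
    (\<Sum>t\<in>T. g t / ((\<Prod>r\<in>T - {t}. t - r) * (\<Prod>r\<in>S. t - r)))"
proof -
  have S: "(\<Prod>r\<in>S \<union> T - {s}. s - r) = (\<Prod>r\<in>S - {s}. s - r) * (\<Prod>r\<in>T. s - r)" if "s \<in> S" for s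
  proof -
    have "S \<union> T - {s} = (S - {s}) \<union> T" using that assms by auto
    then show ?thesis using assms by (simp only:) (subst prod.union_disjoint, auto)
  qed
  have T: "(\<Prod>r\<in>S \<union> T - {t}. t - r) = (\<Prod>r\<in>T - {t}. t - r) * (\<Prod>r\<in>S. t - r)" if "t \<in> T" for t
  proof -
    have "S \<union> T - {t} = (T - {t}) \<union> S" using that assms by auto
    then show ?thesis using assms by (simp only:) (subst prod.union_disjoint, auto)
  qed
  show ?thesis
    unfolding dd_def using S T by (subst sum.union_disjoint[OF assms]) simp
qed

lemma dd_add: "dd S (\<lambda>t. g t + h t) = dd S g + dd S h"
  by (simp add: dd_def add_divide_distrib sum.distrib)

lemma dd_cmult: "dd S (\<lambda>t. c * g t) = c * dd S g"
  by (simp add: dd_def sum_distrib_left)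

text \<open>The factor vanishes at \<open>r\<close> and cancels one factor of the denominator at
  every other node. In this way endpoint factors of a numerator lower the number of nodes.\<close>

lemma dd_mult_linear:
  assumes "finite S" "r \<in> S"
  shows "dd S (\<lambda>t. (t - r) * g t) = dd (S - {r}) g"
proof -
  have "(s - r) * g s / (\<Prod>u\<in>S - {s}. s - u) = g s / (\<Prod>u\<in>S - {r} - {s}. s - u)"
    if "s \<in> S - {r}" for s
  proof -
    have "(\<Prod>u\<in>S - {s}. s - u) = (s - r) * (\<Prod>u\<in>S - {s} - {r}. s - u)"
      using assms that by (intro prod.remove) auto
    moreover have "S - {s} - {r} = S - {r} - {s}" by auto
    ultimately show ?thesis using that by simp
  qed
  then show ?thesis
    unfolding dd_def by (subst sum.remove[OF assms]) simp
qed

section \<open>Lagrange interpolation and divided differences of polynomials\<close>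

lemma lagrange_interpolation:
  fixes p :: "real poly"
  assumes "finite S" "degree p < card S"
  shows "p = (\<Sum>s\<in>S. Polynomial.smult (poly p s / (\<Prod>r\<in>S - {s}. s - r)) (\<Prod>r\<in>S - {s}. [:- r, 1:]))"
proof (rule poly_eqI_degree)
  let ?L = "\<lambda>s. Polynomial.smult (poly p s / (\<Prod>r\<in>S - {s}. s - r)) (\<Prod>r\<in>S - {s}. [:- r, 1:])"
  show "card S > degree p" by fact
  have "degree (\<Sum>s\<in>S. ?L s) \<le> card S - 1"
  proof (rule degree_sum_le[OF assms(1)])
    fix s assume "s \<in> S"
    have "degree (?L s) \<le> degree (\<Prod>r\<in>S - {s}. [:- r, 1:])" by (rule degree_smult_le)
    also have "\<dots> = card (S - {s})"
      by (subst degree_prod_eq_sum_degree) auto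
    finally show "degree (?L s) \<le> card S - 1" using \<open>s \<in> S\<close> assms by simp
  qed
  then show "card S > degree (\<Sum>s\<in>S. ?L s)" using assms(2) by linarith
  fix x assume x: "x \<in> S"
  have z: "poly (?L s) x = 0" if "s \<in> S - {x}" for s
    using that x assms(1) by (auto simp: poly_prod)
  have "poly (\<Sum>s\<in>S. ?L s) x = (\<Sum>s\<in>S. poly (?L s) x)" by (simp add: poly_sum)
  also have "\<dots> = poly (?L x) x + (\<Sum>s\<in>S - {x}. poly (?L s) x)"
    using assms x by (intro sum.remove) auto
  also have "(\<Sum>s\<in>S - {x}. poly (?L s) x) = 0"
    by (rule sum.neutral) (rule ballI, rule z)
  also have "poly (?L x) x + 0 = poly p x" using assms(1) by (auto simp: poly_prod)
  finally show "poly p x = poly (\<Sum>s\<in>S. ?L s) x" by simp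
qed

text \<open>Compare the coefficients of degree \<open>card S - 1\<close> in the interpolation
  formula: each basis product is monic of exactly that degree.\<close>

lemma dd_poly:
  assumes S: "finite S" and deg: "degree p < card S"
  shows "dd S (poly p) = coeff p (card S - 1)"
proof -
  have "coeff (\<Prod>r\<in>S - {s}. [:- r, 1:]) (card S - 1) = (1 :: real)" if "s \<in> S" for s
  proof -
    have "degree (\<Prod>r\<in>S - {s}. [:- r, 1:]) = card S - 1"
      using that S by (subst degree_prod_eq_sum_degree) auto
    then show ?thesis using lead_coeff_prod[of "\<lambda>r. [:- r, 1:]" "S - {s}"] by simp
  qed
  then show ?thesis
    by (subst (2) lagrange_interpolation[OF assms]) (simp add: coeff_sum dd_def)
qed

lemma dd_poly_eq_0:
  assumes "finite S" "degree p + 1 < card S"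
  shows "dd S (poly p) = 0"
  using assms by (simp add: dd_poly coeff_eq_0)

section \<open>Polynomials that are nonnegative outside an interval\<close>

text \<open>The parameter \<open>d\<close> is a degree bound and its parity is the sign condition: members of the cone are
  nonnegative on \<open>t > b\<close> and have the sign \<open>(-1) ^ d\<close> on \<open>t < a\<close>.  Lemma \<open>outer_coneI\<close> below is the converse.\<close>

inductive outer_cone :: "real \<Rightarrow> real \<Rightarrow> nat \<Rightarrow> real poly \<Rightarrow> bool" for a b d where
  zero: "outer_cone a b d 0"
| add: "outer_cone a b d p \<Longrightarrow> outer_cone a b d p' \<Longrightarrow> outer_cone a b d (p + p')"
| square: "even d \<Longrightarrow> 2 * degree q \<le> d \<Longrightarrow> outer_cone a b d (q\<^sup>2)"
| both: "even d \<Longrightarrow> 2 * degree q + 2 \<le> d \<Longrightarrow> outer_cone a b d (q\<^sup>2 * ([:- a, 1:] * [:- b, 1:]))"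
| left: "odd d \<Longrightarrow> 2 * degree q + 1 \<le> d \<Longrightarrow> outer_cone a b d (q\<^sup>2 * [:- a, 1:])"
| right: "odd d \<Longrightarrow> 2 * degree q + 1 \<le> d \<Longrightarrow> outer_cone a b d (q\<^sup>2 * [:- b, 1:])"

text \<open>In every generator \<open>w\<close> is absorbed into \<open>q\<close>, which raises the
  degree bound by two and keeps its parity.\<close>

lemma outer_cone_mult_square:
  assumes "outer_cone a b d p" "degree w \<le> 1"
  shows "outer_cone a b (d + 2) (p * w\<^sup>2)"
  using assms(1)
proof induction
  case (add p p')
  then show ?case by (simp add: distrib_right outer_cone.add)
next
  case (square q)
  then show ?case using outer_cone.square[of "d + 2" "q * w" a b] degree_mult_le[of q w] assms(2)
    by (simp add: power_mult_distrib)
next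
  case (both q)
  then show ?case using outer_cone.both[of "d + 2" "q * w" a b] degree_mult_le[of q w] assms(2)
    by (simp only: power_mult_distrib mult_ac) simp
next
  case (left q)
  then show ?case using outer_cone.left[of "d + 2" "q * w" a b] degree_mult_le[of q w] assms(2)
    by (simp only: power_mult_distrib mult_ac) simp
next
  case (right q)
  then show ?case using outer_cone.right[of "d + 2" "q * w" a b] degree_mult_le[of q w] assms(2)
    by (simp only: power_mult_distrib mult_ac) simp
qed (simp add: outer_cone.zero)

text \<open>The scalar enters each square as \<open>sqrt c\<close>.\<close>

lemma outer_cone_smult:
  assumes "outer_cone a b d p" "c \<ge> 0"
  shows "outer_cone a b d (Polynomial.smult c p)"
proof -
  have sq: "Polynomial.smult c (q\<^sup>2) = (Polynomial.smult (sqrt c) q)\<^sup>2" for q :: "real poly"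
    using assms(2) by (simp add: power2_eq_square)
  have deg: "degree (Polynomial.smult (sqrt c) q) \<le> degree q" for q :: "real poly"
    by (rule degree_smult_le)
  show ?thesis
    using assms(1)
  proof induction
    case (add p p')
    then show ?case by (simp add: smult_add_right outer_cone.add)
  next
    case (square q)
    then show ?case unfolding sq using deg[of q] by (intro outer_cone.square) auto
  next
    case (both q)
    then show ?case unfolding mult_smult_left[symmetric] sq using deg[of q]
      by (intro outer_cone.both) auto
  next
    case (left q)
    then show ?case unfolding mult_smult_left[symmetric] sq using deg[of q]
      by (intro outer_cone.left) auto
  next
    case (right q)
    then show ?case unfolding mult_smult_left[symmetric] sq using deg[of q]
      by (intro outer_cone.right) auto
  qed (simp add: outer_cone.zero)
qed

text \<open>The generators are exchanged: an endpoint factor that is already present completes a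
  square and moves into \<open>q\<close>, a new one is kept as a factor.\<close>

lemma outer_cone_mult_endpoint:
  assumes "outer_cone a b d p" "c \<in> {a, b}"
  shows "outer_cone a b (Suc d) (p * [:- c, 1:])"
proof -
  have deg: "degree (q * [:- e, 1:]) \<le> degree q + 1" for q :: "real poly" and e
    using degree_mult_le[of q "[:- e, 1:]"] by simp
  show ?thesis
    using assms(1)
  proof induction
    case (add p p')
    then show ?case by (simp add: ring_distribs del: mult_pCons_right) (metis outer_cone.add)
  next
    case (square q)
    then show ?case
      using assms(2) outer_cone.left[of "Suc d" q a b] outer_cone.right[of "Suc d" q a b]
      by auto
  next
    case (both q)
    have "q\<^sup>2 * ([:- a, 1:] * [:- b, 1:]) * [:- a, 1:] = (q * [:- a, 1:])\<^sup>2 * [:- b, 1:]"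
      and "q\<^sup>2 * ([:- a, 1:] * [:- b, 1:]) * [:- b, 1:] = (q * [:- b, 1:])\<^sup>2 * [:- a, 1:]"
      by (simp_all only: power2_eq_square mult_ac)
    then show ?case
      using assms(2) both deg[of q a] deg[of q b]
        outer_cone.left[of "Suc d" "q * [:- b, 1:]" a b]
        outer_cone.right[of "Suc d" "q * [:- a, 1:]" a b]
      by auto
  next
    case (left q)
    have "q\<^sup>2 * [:- a, 1:] * [:- a, 1:] = (q * [:- a, 1:])\<^sup>2"
      and "q\<^sup>2 * [:- a, 1:] * [:- b, 1:] = q\<^sup>2 * ([:- a, 1:] * [:- b, 1:])"
      by (simp_all only: power2_eq_square mult_ac)
    then show ?case
      using assms(2) left deg[of q a]
        outer_cone.square[of "Suc d" "q * [:- a, 1:]" a b] outer_cone.both[of "Suc d" q a b]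
      by auto
  next
    case (right q)
    have "q\<^sup>2 * [:- b, 1:] * [:- b, 1:] = (q * [:- b, 1:])\<^sup>2"
      and "q\<^sup>2 * [:- b, 1:] * [:- a, 1:] = q\<^sup>2 * ([:- a, 1:] * [:- b, 1:])"
      by (simp_all only: power2_eq_square mult_ac)
    then show ?case
      using assms(2) right deg[of q b]
        outer_cone.square[of "Suc d" "q * [:- b, 1:]" a b] outer_cone.both[of "Suc d" q a b]
      by auto
  qed (simp add: outer_cone.zero)
qed

text \<open>A point of \<open>[a, b]\<close> is a convex combination of the endpoints, so its linear
  factor is the same combination of the two endpoint factors, and the cone is convex.\<close>

lemma outer_cone_mult_inner:
  assumes p: "outer_cone a b d p" and r: "a \<le> r" "r \<le> b"
  shows "outer_cone a b (Suc d) (p * [:- r, 1:])"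
proof -
  obtain l where l: "0 \<le> l" "l \<le> 1" "r = l * a + (1 - l) * b"
  proof (cases "a = b")
    case True
    then show ?thesis using that[of 1] r by simp
  next
    case False
    then have "r = (b - r) / (b - a) * a + (1 - (b - r) / (b - a)) * b"
      using r by (simp add: divide_simps) (simp add: algebra_simps)
    moreover have "0 \<le> (b - r) / (b - a)" "(b - r) / (b - a) \<le> 1" using r False by auto
    ultimately show ?thesis using that by blast
  qed
  have "[:- r, 1:] = Polynomial.smult l [:- a, 1:] + Polynomial.smult (1 - l) [:- b, 1:]"
    unfolding l(3) by simp
  then have "p * [:- r, 1:] = Polynomial.smult l (p * [:- a, 1:]) + Polynomial.smult (1 - l) (p * [:- b, 1:])"
    by (simp only: distrib_left mult_smult_right)
  then show ?thesis
    using l by (auto intro!: outer_cone.add outer_cone_smult outer_cone_mult_endpoint p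
      simp del: mult_pCons_right)
qed

text \<open>Division by the real quadratic with roots \<open>z\<close> and its conjugate leaves a
  real remainder of degree at most one that vanishes at the nonreal \<open>z\<close>, hence zero.
  The quadratic is written as a sum of two squares to fit
  \<open>outer_cone_mult_square\<close>.\<close>

lemma nonreal_root_factor:
  fixes p :: "real poly"
  assumes root: "poly (map_poly complex_of_real p) z = 0" and im: "Im z \<noteq> 0"
  shows "[:- Re z, 1:]\<^sup>2 + [:Im z:]\<^sup>2 dvd p"
proof -
  let ?c = "map_poly complex_of_real"
  let ?Q = "[:(Re z)\<^sup>2 + (Im z)\<^sup>2, - 2 * Re z, 1:]"
  have lin: "\<exists>u v. r = [:u, v:]" if "degree r < 2" for r :: "real poly"
  proof -
    obtain u s where r: "r = pCons u s" by (cases r)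
    then have "degree s = 0" using that by (cases "s = 0") auto
    then obtain v where "s = [:v:]" by (rule degree_eq_zeroE)
    then show ?thesis using r by blast
  qed
  have "degree (p mod ?Q) < 2"
    using degree_mod_less[of ?Q p] by fastforce
  from lin[OF this] obtain u v where m: "p mod ?Q = [:u, v:]" by blast
  have "poly (?c ?Q) z = of_real ((Re z)\<^sup>2 + (Im z)\<^sup>2) + z * (of_real (- 2 * Re z) + z)"
    by (simp add: map_poly_pCons)
  also have "\<dots> = 0"
    by (intro complex_eqI) (simp_all add: power2_eq_square algebra_simps)
  finally have Qz: "poly (?c ?Q) z = 0" .
  have hom: "?c (u * v + w) = ?c u * ?c v + ?c w" for u v w :: "real poly"
    by (intro poly_eqI) (simp add: coeff_map_poly coeff_mult)
  have "?c p = ?c (p div ?Q * ?Q + p mod ?Q)"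
    by (simp only: div_mult_mod_eq)
  also have "\<dots> = ?c (p div ?Q) * ?c ?Q + ?c [:u, v:]"
    by (simp only: hom m)
  finally have "poly (?c [:u, v:]) z = 0" using root Qz by (simp only: poly_add poly_mult) simp
  then have "of_real u + z * of_real v = 0" by (cases "v = 0"; cases "u = 0") (simp_all add: map_poly_pCons)
  then have "v = 0 \<and> u = 0" using im by (auto simp: complex_eq_iff)
  then have "?Q dvd p" using m by (simp only: dvd_eq_mod_eq_0) simp
  moreover have "[:- Re z, 1:]\<^sup>2 + [:Im z:]\<^sup>2 = ?Q" by (simp add: power2_eq_square)
  ultimately show ?thesis by (simp only:)
qed

text \<open>In \<open>p = (t - r) * q\<close> the quotient is nonnegative to the right of
  \<open>r\<close> and nonpositive to the left, so the one-sided limits force \<open>q\<close> to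
  vanish at \<open>r\<close> too.\<close>

lemma square_root_factor:
  fixes p :: "real poly"
  assumes sign: "\<And>t. c < t \<Longrightarrow> t < d \<Longrightarrow> t \<noteq> r \<Longrightarrow> 0 \<le> poly p t" and r: "c < r" "r < d"
    and root: "poly p r = 0"
  obtains p' where "p = p' * [:- r, 1:]\<^sup>2"
proof -
  obtain q where q: "p = [:- r, 1:] * q" using root by (auto simp: poly_eq_0_iff_dvd)
  have pq: "poly p t = (t - r) * poly q t" for t by (simp add: q algebra_simps)
  have "0 \<le> poly q t" if "r < t" "t < d" for t
    using sign[of t] that r by (simp add: pq zero_le_mult_iff)
  then have "eventually (\<lambda>t. 0 \<le> poly q t) (at_right r)"
    using r by (auto simp: eventually_at_right)
  moreover have "(poly q \<longlongrightarrow> poly q r) (at_right r)" "(poly q \<longlongrightarrow> poly q r) (at_left r)"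
    by (auto intro!: tendsto_intros)
  ultimately have "0 \<le> poly q r"
    by (intro tendsto_lowerbound) auto
  have "poly q t \<le> 0" if "c < t" "t < r" for t
    using sign[of t] that r by (simp add: pq zero_le_mult_iff)
  then have "eventually (\<lambda>t. poly q t \<le> 0) (at_left r)"
    using r by (auto simp: eventually_at_left)
  then have "poly q r \<le> 0"
    using \<open>(poly q \<longlongrightarrow> poly q r) (at_left r)\<close> by (intro tendsto_upperbound) auto
  with \<open>0 \<le> poly q r\<close> have "poly q r = 0" by simp
  then obtain p' where "q = [:- r, 1:] * p'" by (auto simp: poly_eq_0_iff_dvd)
  then show ?thesis using that[of p'] q by (simp only: power2_eq_square mult_ac)
qed

text \<open>By continuity. It restores the sign of a quotient at the zero of the divisor.\<close>

lemma poly_nonneg_off_point: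
  fixes p :: "real poly"
  assumes "\<And>t. c < t \<Longrightarrow> t < d \<Longrightarrow> t \<noteq> r \<Longrightarrow> 0 \<le> poly p t" and "c < r" "r < d"
  shows "0 \<le> poly p r"
proof -
  have "eventually (\<lambda>t. 0 \<le> poly p t) (at_right r)"
    using assms by (auto simp: eventually_at_right)
  moreover have "(poly p \<longlongrightarrow> poly p r) (at_right r)"
    by (auto intro!: tendsto_intros)
  ultimately show ?thesis
    by (intro tendsto_lowerbound) auto
qed

text \<open>Induction on \<open>d\<close>, splitting off roots. A root in \<open>[a, b]\<close>
  lowers \<open>d\<close> by one and flips the sign on the left. A real root outside splits off as a
  square, since no sign change happens there. A nonreal pair splits off as a sum of two
  squares.\<close>

lemma outer_coneI:
  assumes ab: "a \<le> b" and "degree p \<le> d"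
    and "\<And>t. b < t \<Longrightarrow> 0 \<le> poly p t" "\<And>t. t < a \<Longrightarrow> 0 \<le> (-1) ^ d * poly p t"
  shows "outer_cone a b d p"
  using assms(2-)
proof (induction d arbitrary: p rule: less_induct)
  case (less d)
  note pos = less.prems(2) and neg = less.prems(3)
  \<comment> \<open>Common to the last two kinds of roots: dividing by a factor that is positive off
    \<open>e\<close> keeps both sign conditions and lowers \<open>d\<close> by two.\<close>
  have square_case: "outer_cone a b (d - 2) p' \<and> Suc (Suc (d - 2)) = d"
    if p: "p \<noteq> 0" "degree p = degree p' + 2"
      and w: "\<And>t. t \<noteq> e \<Longrightarrow> \<exists>c>0. poly p t = c * poly p' t" for p' e
  proof -
    have d: "Suc (Suc (d - 2)) = d" using p less.prems(1) by simp
    then have sg: "(-1 :: real) ^ (d - 2) = (-1) ^ d"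
      by (metis mult_minus1 power_Suc minus_minus)
    have "0 \<le> poly p' t" if "b < t" for t
    proof -
      have *: "0 \<le> poly p' u" if "b < u" "u \<noteq> e" for u
        using w[OF that(2)] pos[OF that(1)] by (auto simp: zero_le_mult_iff)
      show ?thesis
        using poly_nonneg_off_point[of b "t + 1" t p'] * that by (cases "t = e") auto
    qed
    moreover have "0 \<le> (-1) ^ (d - 2) * poly p' t" if "t < a" for t
    proof -
      have *: "0 \<le> poly (Polynomial.smult ((-1) ^ d) p') u" if "u < a" "u \<noteq> e" for u
        using w[OF that(2)] neg[OF that(1)] by (cases "even d") (auto simp: zero_le_mult_iff mult_le_0_iff)
      show ?thesis
        using poly_nonneg_off_point[of "t - 1" a t "Polynomial.smult ((-1) ^ d) p'"] * that sg
        by (cases "t = e") auto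
    qed
    moreover have "degree p' \<le> d - 2" "d - 2 < d" using less.prems(1) p d by auto
    ultimately show ?thesis using less.IH[of "d - 2" p'] d by blast
  qed
  consider "degree p = 0" | r where "p \<noteq> 0" "degree p \<noteq> 0" "poly p r = 0"
    | "degree p \<noteq> 0" "\<And>r. poly p r \<noteq> 0" by fastforce
  then show ?case
  proof cases
    case 1
    then obtain c where c: "p = [:c:]" by (rule degree_eq_zeroE)
    have "0 \<le> c" using pos[of "b + 1"] c by simp
    show ?thesis
    proof (cases "even d")
      case True
      have "p = [:sqrt c:]\<^sup>2" using c \<open>0 \<le> c\<close> by (simp add: power2_eq_square)
      then show ?thesis using outer_cone.square[OF True, of "[:sqrt c:]"] by simp
    next
      case False
      \<comment> \<open>For odd \<open>d\<close> the two half lines demand opposite signs of the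
        constant.\<close>
      then have "c = 0" using neg[of "a - 1"] c \<open>0 \<le> c\<close> by simp
      then show ?thesis using c by (simp add: outer_cone.zero)
    qed
  next
    case (2 r)
    show ?thesis
    proof (cases "a \<le> r \<and> r \<le> b")
      case True
      obtain q where q: "p = q * [:- r, 1:]"
        using 2(3) by (metis dvdE mult.commute poly_eq_0_iff_dvd)
      have deg: "degree p = degree q + 1"
        using q 2(1) by (auto simp: degree_mult_eq simp del: mult_pCons_right)
      then obtain e where e: "d = Suc e" using less.prems(1) by (cases d) auto
      have pq: "poly p t = (t - r) * poly q t" for t by (simp add: q algebra_simps)
      have "0 \<le> poly q t" if "b < t" for t
        using pos[OF that] True that by (simp add: pq zero_le_mult_iff)
      moreover have "0 \<le> (-1) ^ e * poly q t" if "t < a" for t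
        using neg[OF that] True that
        by (cases "even e") (auto simp: pq e zero_le_mult_iff mult_le_0_iff)
      ultimately have "outer_cone a b e q"
        using less.IH[of e q] e less.prems(1) deg by simp
      then show ?thesis using outer_cone_mult_inner True unfolding q e by blast
    next
      case False
      obtain q where q: "p = q * [:- r, 1:]\<^sup>2"
      proof (cases "b < r")
        case True
        then show ?thesis using square_root_factor[of b "r + 1" r p] pos 2(3) that by auto
      next
        case False
        then have "r < a" using \<open>\<not> (a \<le> r \<and> r \<le> b)\<close> by simp
        \<comment> \<open>Left of \<open>a\<close> it is \<open>(-1) ^ d * p\<close> that is
          nonnegative; the sign is undone after factoring.\<close>
        have eq: "p = Polynomial.smult ((-1) ^ d) (Polynomial.smult ((-1) ^ d) p)"
          by (simp flip: power_mult_distrib)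
        obtain q where "Polynomial.smult ((-1) ^ d) p = q * [:- r, 1:]\<^sup>2"
          using square_root_factor[of "r - 1" a r "Polynomial.smult ((-1) ^ d) p"] neg 2(3) \<open>r < a\<close>
          by auto
        then have "p = Polynomial.smult ((-1) ^ d) q * [:- r, 1:]\<^sup>2"
          using eq by (metis mult_smult_left)
        then show ?thesis by (rule that)
      qed
      have "degree p = degree q + 2"
        using q 2(1) by (auto simp: degree_mult_eq degree_power_eq simp del: mult_pCons_right)
      moreover have "\<exists>c>0. poly p t = c * poly q t" if "t \<noteq> r" for t
        using that q by (intro exI[of _ "(t - r)\<^sup>2"]) simp
      ultimately have "outer_cone a b (d - 2) q" "Suc (Suc (d - 2)) = d"
        using square_case[of q r] 2(1) by auto
      then show ?thesis using outer_cone_mult_square[of a b "d - 2" q "[:- r, 1:]"] q by simp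
    qed
  next
    case 3
    let ?c = "map_poly complex_of_real p"
    have "\<not> constant (poly ?c)" using 3(1) by (simp add: constant_degree)
    then obtain z where z: "poly ?c z = 0" using fundamental_theorem_of_algebra by blast
    have eval: "poly (map_poly complex_of_real u) (of_real x) = of_real (poly u x)" for u x
      by (induction u) (simp_all add: map_poly_pCons)
    have "Im z \<noteq> 0"
    proof
      assume "Im z = 0"
      then have "z = of_real (Re z)" by (simp add: complex_eq_iff)
      then show False using z 3(2) by (metis of_real_eq_0_iff eval)
    qed
    then obtain q where "p = ([:- Re z, 1:]\<^sup>2 + [:Im z:]\<^sup>2) * q"
      using nonreal_root_factor[OF z] by (auto elim: dvdE)
    then have q: "p = q * ([:- Re z, 1:]\<^sup>2 + [:Im z:]\<^sup>2)" by (simp only: mult.commute)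
    have nz: "p \<noteq> 0" using 3(1) by auto
    have "[:- Re z, 1:]\<^sup>2 + [:Im z:]\<^sup>2 = [:(Re z)\<^sup>2 + (Im z)\<^sup>2, - 2 * Re z, 1:]"
      by (simp add: power2_eq_square)
    then have "degree ([:- Re z, 1:]\<^sup>2 + [:Im z:]\<^sup>2) = 2" by simp
    then have "degree p = degree q + 2"
      using q nz degree_mult_eq[of q "[:- Re z, 1:]\<^sup>2 + [:Im z:]\<^sup>2"] by fastforce
    moreover have "\<exists>c>0. poly p t = c * poly q t" for t
      using \<open>Im z \<noteq> 0\<close> q by (intro exI[of _ "(t - Re z)\<^sup>2 + (Im z)\<^sup>2"]) (simp add: add_nonneg_pos)
    \<comment> \<open>The quadratic has no real zero, so the exceptional point \<open>0\<close> is
      an arbitrary choice.\<close>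
    ultimately have "outer_cone a b (d - 2) q" "Suc (Suc (d - 2)) = d"
      using square_case[of q 0] nz by auto
    then show ?thesis
      using outer_cone_mult_square[of a b "d - 2" q "[:- Re z, 1:]"]
        outer_cone_mult_square[of a b "d - 2" q "[:Im z:]"]
      unfolding q by (simp add: distrib_left outer_cone.add del: mult_pCons_right)
  qed
qed

section \<open>The divided difference conditions\<close>

definition dd_cond :: "real set \<Rightarrow> (real \<Rightarrow> real) \<Rightarrow> nat \<Rightarrow> bool" where
  "dd_cond F f k \<longleftrightarrow> (\<forall>X q. X \<subseteq> F \<and> finite X \<and> card X = 2 * k \<and> degree q \<le> k - 1 \<longrightarrow>
     0 \<le> dd X (\<lambda>t. f t * (poly q t)\<^sup>2))"

lemma dd_condI:
  assumes "\<And>X q. X \<subseteq> F \<Longrightarrow> finite X \<Longrightarrow> card X = 2 * k \<Longrightarrow> degree q \<le> k - 1 \<Longrightarrow>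
    0 \<le> dd X (\<lambda>t. f t * (poly q t)\<^sup>2)"
  shows "dd_cond F f k"
  using assms by (auto simp: dd_cond_def)

lemma dd_condD:
  assumes "dd_cond F f k" "X \<subseteq> F" "finite X" "card X = 2 * k" "degree q \<le> k - 1"
  shows "0 \<le> dd X (\<lambda>t. f t * (poly q t)\<^sup>2)"
  using assms by (auto simp: dd_cond_def)

lemma dd_cond_iff:
  assumes "1 \<le> k"
  shows "dd_cond F f k \<longleftrightarrow>
    (\<forall>x q. inj_on x {..2 * k - 1} \<and> x ` {..2 * k - 1} \<subseteq> F \<and> degree q \<le> k - 1 \<longrightarrow>
      divided_diff x (2 * k - 1) (\<lambda>t. f t * (poly q t)\<^sup>2) \<ge> 0)" (is "_ \<longleftrightarrow> ?R")
proof
  assume "dd_cond F f k"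
  then show ?R using assms by (auto simp: divided_diff_eq_dd card_image intro!: dd_condD)
next
  assume R: ?R
  show "dd_cond F f k"
  proof (rule dd_condI)
    fix X and q :: "real poly" assume X: "X \<subseteq> F" "finite X" "card X = 2 * k" and q: "degree q \<le> k - 1"
    obtain x where x: "bij_betw x {..<2 * k} X"
      using ex_bij_betw_nat_finite[OF X(2)] X(3) by (auto simp: atLeast0LessThan)
    \<comment> \<open>This is where \<open>k \<ge> 1\<close> enters: for \<open>k = 0\<close>
      truncated subtraction would leave one index on the right.\<close>
    moreover have "{..<2 * k} = {..2 * k - 1}" using assms by auto
    ultimately have inj: "inj_on x {..2 * k - 1}" and img: "x ` {..2 * k - 1} = X"
      by (auto simp: bij_betw_def)
    then have "0 \<le> divided_diff x (2 * k - 1) (\<lambda>t. f t * (poly q t)\<^sup>2)"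
      using R X(1) q by blast
    then show "0 \<le> dd X (\<lambda>t. f t * (poly q t)\<^sup>2)"
      unfolding divided_diff_eq_dd[OF inj] img .
  qed
qed

text \<open>The bound on \<open>card F\<close> leaves three points outside a set of
  \<open>2 * k\<close> nodes: two are adjoined for each test, and the third allows the sign of the
  error term to be chosen.\<close>

lemma dd_cond_descend:
  assumes cond: "dd_cond F f (Suc k)" and k: "1 \<le> k" and F: "infinite F \<or> 2 * k + 3 \<le> card F"
  shows "dd_cond F f k"
proof (rule dd_condI)
  fix X and q :: "real poly" assume X: "X \<subseteq> F" "finite X" "card X = 2 * k" and q: "degree q \<le> k - 1"
  define h where "h = (\<lambda>t. f t * (poly q t)\<^sup>2)"
  have "infinite (F - X) \<or> 3 \<le> card (F - X)"
    using F X card_Diff_subset[of X F] by (cases "finite F") auto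
  then obtain T where T: "T \<subseteq> F - X" "card T = 3" "finite T"
    by (metis infinite_arbitrarily_large obtain_subset_with_card_n)
  (* Test the condition for k + 1 on X with y and z adjoined and the polynomial q (t - y). *)
  have key: "0 \<le> dd X h + (z - y) * dd (insert z X) h" if yz: "y \<in> F - X" "z \<in> F - X" "y \<noteq> z" for y z
  proof -
    have "degree (q * [:- y, 1:]) \<le> Suc k - 1"
      using degree_mult_le[of q "[:- y, 1:]"] q k by simp
    then have "0 \<le> dd (insert y (insert z X)) (\<lambda>t. f t * (poly (q * [:- y, 1:]) t)\<^sup>2)"
      using yz X by (intro dd_condD[OF cond]) auto
    also have "(\<lambda>t. f t * (poly (q * [:- y, 1:]) t)\<^sup>2) = (\<lambda>t. (t - y) * ((t - y) * h t))"
      by (simp add: fun_eq_iff h_def power2_eq_square algebra_simps)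
    also have "dd (insert y (insert z X)) \<dots> = dd (insert z X) (\<lambda>t. (t - y) * h t)"
      using yz X by (subst dd_mult_linear) (auto intro!: arg_cong[of _ _ "\<lambda>S. dd S _"])
    also have "(\<lambda>t. (t - y) * h t) = (\<lambda>t. (t - z) * h t + (z - y) * h t)"
      by (simp add: fun_eq_iff algebra_simps)
    also have "dd (insert z X) \<dots> = dd X h + (z - y) * dd (insert z X) h"
      unfolding dd_add dd_cmult using yz X by (subst dd_mult_linear) auto
    finally show ?thesis .
  qed
  define y w where "y = Min T" and "w = Max T"
  have "\<not> T \<subseteq> {y, w}"
    using card_mono[of "{y, w}" T] T by (auto simp: card_insert_if split: if_splits)
  then obtain z where "z \<in> T" "z \<noteq> y" "z \<noteq> w" by blast
  moreover from this have "T \<noteq> {}" by blast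
  moreover have "y \<in> T" "w \<in> T" "y \<le> z" "z \<le> w"
    using T \<open>z \<in> T\<close> \<open>T \<noteq> {}\<close> by (auto simp: y_def w_def)
  ultimately have yzw: "y < z" "z < w" "y \<in> F - X" "z \<in> F - X" "w \<in> F - X"
    using T by auto
  (* As z lies strictly between y and w, one of (z - y) and (z - w) makes the second summand of key nonpositive. *)
  show "0 \<le> dd X (\<lambda>t. f t * (poly q t)\<^sup>2)"
  proof (cases "dd (insert z X) h \<le> 0")
    case True
    then have "(z - y) * dd (insert z X) h \<le> 0" using yzw by (simp add: mult_le_0_iff)
    then show ?thesis using key[of y z] yzw unfolding h_def by linarith
  next
    case False
    then have "(z - w) * dd (insert z X) h \<le> 0" using yzw by (simp add: mult_le_0_iff)
    then show ?thesis using key[of w z] yzw unfolding h_def by linarith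
  qed
qed

text \<open>The endpoints are nodes, so each generator sheds its linear factors together with those
  nodes. By parity an even number \<open>2 * k\<close> of nodes remains, and the degree bound
  becomes \<open>degree q \<le> k - 1\<close>.\<close>

lemma outer_cone_dd_nonneg:
  assumes S: "finite S" "S \<subseteq> F" "2 \<le> card S" and cond: "\<And>k. 1 \<le> k \<Longrightarrow> 2 * k \<le> card S \<Longrightarrow> dd_cond F f k"
    and p: "outer_cone (Min S) (Max S) (card S - 2) p"
  shows "0 \<le> dd S (\<lambda>t. f t * poly p t)"
proof -
  have "S \<noteq> {}" using S by auto
  then have MM: "Min S \<in> S" "Max S \<in> S" using S by auto
  have ne: "Min S \<noteq> Max S"
  proof
    assume "Min S = Max S"
    then have "S \<subseteq> {Min S}" using S by (metis Max_ge Min_le antisym singletonI subsetI)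
    then have "card S \<le> 1" using card_mono[of "{Min S}" S] by simp
    then show False using S by simp
  qed
  have rem: "dd S (\<lambda>t. f t * poly (q\<^sup>2 * [:- r, 1:]) t) = dd (S - {r}) (\<lambda>t. f t * (poly q t)\<^sup>2)"
    if "r \<in> S" for r q
    using dd_mult_linear[OF S(1) that, of "\<lambda>t. f t * (poly q t)\<^sup>2"]
    by (simp add: algebra_simps)
  have odd_case: "0 \<le> dd S (\<lambda>t. f t * poly (q\<^sup>2 * [:- r, 1:]) t)"
    if r: "r \<in> S" and q: "odd (card S - 2)" "2 * degree q + 1 \<le> card S - 2" for q r
  proof -
    define k where "k = card S div 2"
    have k: "card S = 2 * k + 1" using q S(3) unfolding k_def by presburger
    show ?thesis
      unfolding rem[OF r] using r q k S
      by (intro dd_condD[OF cond[of k]]) auto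
  qed
  show ?thesis
    using p
  proof induction
    case zero
    then show ?case by (simp add: dd_def)
  next
    case (add p p')
    then show ?case by (simp add: distrib_left dd_add)
  next
    case (square q)
    define k where "k = card S div 2"
    have k: "card S = 2 * k" using \<open>even (card S - 2)\<close> S(3) unfolding k_def by presburger
    show ?case
      using dd_condD[OF cond[of k], of S q] square k S by simp
  next
    case (both q)
    define k where "k = card S div 2"
    have k: "card S = 2 * k" using \<open>even (card S - 2)\<close> S(3) unfolding k_def by presburger
    have "dd S (\<lambda>t. f t * poly (q\<^sup>2 * ([:- Min S, 1:] * [:- Max S, 1:])) t) =
      dd S (\<lambda>t. (t - Min S) * ((t - Max S) * (f t * (poly q t)\<^sup>2)))"
      by (rule arg_cong[of _ _ "dd S"]) (simp add: fun_eq_iff algebra_simps)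
    also have "\<dots> = dd (S - {Min S} - {Max S}) (\<lambda>t. f t * (poly q t)\<^sup>2)"
      using S MM ne by (simp add: dd_mult_linear)
    \<comment> \<open>The degree bound of this generator gives \<open>k \<ge> 2\<close>, so
      \<open>k - 1\<close> is an admissible index.\<close>
    also have "\<dots> \<ge> 0"
      using both k S MM ne by (intro dd_condD[OF cond[of "k - 1"]]) auto
    finally show ?case .
  next
    case (left q)
    then show ?case using odd_case[OF MM(1)] by blast
  next
    case (right q)
    then show ?case using odd_case[OF MM(2)] by blast
  qed
qed

section \<open>Spectral decompositions\<close>

lemma mat_adjoint_dim [simp]:
  "dim_row (mat_adjoint A) = dim_col A" "dim_col (mat_adjoint A) = dim_row A"
  by (simp_all add: mat_adjoint_def)

lemma mat_adjoint_index:
  assumes "i < dim_col A" "j < dim_row A"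
  shows "mat_adjoint A $$ (i, j) = conjugate (A $$ (j, i))"
  using assms by (simp add: mat_adjoint_def mat_of_rows_index)

lemma mat_adjoint_adjoint [simp]: "mat_adjoint (mat_adjoint A) = (A :: complex mat)"
  by (rule eq_matI) (simp_all add: mat_adjoint_index)

lemma mat_adjoint_mult:
  fixes A B :: "complex mat"
  assumes "dim_col A = dim_row B"
  shows "mat_adjoint (A * B) = mat_adjoint B * mat_adjoint A"
  using assms
  by (intro eq_matI) (simp_all add: mat_adjoint_index scalar_prod_def mult.commute)

lemma mat_adjoint_diag_real:
  "mat_adjoint (mat_diag n (\<lambda>i. complex_of_real (d i))) = mat_diag n (\<lambda>i. complex_of_real (d i))"
  by (intro eq_matI) (auto simp: mat_adjoint_index mat_diag_def)

lemma mat_adjoint_one [simp]: "mat_adjoint (1\<^sub>m n) = (1\<^sub>m n :: complex mat)"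
  by (intro eq_matI) (simp_all add: mat_adjoint_index)

lemma cscalar_mult_mat_vec:
  fixes A :: "complex mat"
  assumes "A \<in> carrier_mat m n" "v \<in> carrier_vec n" "w \<in> carrier_vec m"
  shows "(A *\<^sub>v v) \<bullet>c w = v \<bullet>c (mat_adjoint A *\<^sub>v w)"
proof -
  have "(A *\<^sub>v v) \<bullet>c w = (\<Sum>i<m. \<Sum>j<n. A $$ (i, j) * v $ j * cnj (w $ i))"
    using assms by (simp add: scalar_prod_def atLeast0LessThan sum_distrib_right)
  also have "\<dots> = (\<Sum>j<n. \<Sum>i<m. A $$ (i, j) * v $ j * cnj (w $ i))"
    by (rule sum.swap)
  also have "\<dots> = v \<bullet>c (mat_adjoint A *\<^sub>v w)"
    using assms by (simp add: scalar_prod_def atLeast0LessThan sum_distrib_left mat_adjoint_index mult_ac)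
  finally show ?thesis .
qed

lemma mult_cnj_cmod: "z * cnj z = (complex_of_real (cmod z))\<^sup>2"
  using complex_norm_square[of z] by simp

section \<open>Unitary matrices, spectral weights and the Loewner order\<close>

lemma unitary_matD:
  assumes "unitary_mat n U"
  shows "U \<in> carrier_mat n n" "mat_adjoint U \<in> carrier_mat n n"
    "U * mat_adjoint U = 1\<^sub>m n" "mat_adjoint U * U = 1\<^sub>m n"
  using assms by (auto simp: unitary_mat_def mat_adjoint_carrier)

lemma unitary_matI:
  assumes "U \<in> carrier_mat n n" "mat_adjoint U * U = 1\<^sub>m n"
  shows "unitary_mat n U"
  using assms mat_mult_left_right_inverse[of "mat_adjoint U" n U]
  by (auto simp: unitary_mat_def mat_adjoint_carrier)

lemma unitary_mat_mult:
  assumes U: "unitary_mat n U" and V: "unitary_mat n V"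
  shows "unitary_mat n (U * V)"
proof (rule unitary_matI)
  note u = unitary_matD[OF U] and v = unitary_matD[OF V]
  show "U * V \<in> carrier_mat n n" using u v by simp
  have "mat_adjoint (U * V) * (U * V) = mat_adjoint V * (mat_adjoint U * (U * V))"
    using u v by (simp add: mat_adjoint_mult assoc_mult_mat[of _ n n _ n _ n] mult_carrier_mat[of _ n n _ n])
  also have "mat_adjoint U * (U * V) = (mat_adjoint U * U) * V"
    using u v by (intro assoc_mult_mat[symmetric])
  finally show "mat_adjoint (U * V) * (U * V) = 1\<^sub>m n" using u v by simp
qed

text \<open>The mass that the spectral measure of \<open>v\<close> assigns to the eigenvector in
  column \<open>i\<close> of \<open>U\<close>.\<close>

definition weight :: "complex mat \<Rightarrow> complex vec \<Rightarrow> nat \<Rightarrow> real" where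
  "weight U v i = (cmod ((mat_adjoint U *\<^sub>v v) $ i))\<^sup>2"

lemma mat_diag_mult_vec:
  assumes "w \<in> carrier_vec n"
  shows "mat_diag n d *\<^sub>v w = vec n (\<lambda>i. d i * w $ i)"
proof (rule eq_vecI)
  fix i assume i: "i < dim_vec (vec n (\<lambda>i. d i * w $ i))"
  then have "(mat_diag n d *\<^sub>v w) $ i = (\<Sum>j<n. (if i = j then d j else 0) * w $ j)"
    using assms by (simp add: mat_diag_def scalar_prod_def atLeast0LessThan)
  also have "\<dots> = (\<Sum>j<n. if j = i then d i * w $ i else 0)"
    by (rule sum.cong) auto
  finally have "(mat_diag n d *\<^sub>v w) $ i = (\<Sum>j<n. if j = i then d i * w $ i else 0)" .
  then show "(mat_diag n d *\<^sub>v w) $ i = vec n (\<lambda>i. d i * w $ i) $ i" using i by simp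
qed (simp add: mat_diag_def)

lemma spectral_decompD:
  assumes "spectral_decomp A U d" "A \<in> carrier_mat n n"
  shows "unitary_mat n U" "A = U * mat_diag n (\<lambda>i. complex_of_real (d i)) * mat_adjoint U"
  using assms by (auto simp: spectral_decomp_def)

lemma spectral_decompI:
  assumes "unitary_mat n U" "A = U * mat_diag n (\<lambda>i. complex_of_real (d i)) * mat_adjoint U"
  shows "spectral_decomp A U d" "A \<in> carrier_mat n n"
proof -
  show "A \<in> carrier_mat n n" 
    using unitary_matD[OF assms(1)] unfolding assms(2)
    by (auto intro!: mult_carrier_mat[of _ n n _ n])
  then show "spectral_decomp A U d" using assms by (auto simp: spectral_decomp_def)
qed

lemma quadratic_form_spectral:
  assumes dec: "spectral_decomp A U d" and A: "A \<in> carrier_mat n n" and v: "v \<in> carrier_vec n"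
  shows "(A *\<^sub>v v) \<bullet>c v = complex_of_real (\<Sum>i<n. d i * weight U v i)"
proof -
  let ?D = "mat_diag n (\<lambda>i. complex_of_real (d i))"
  note U = unitary_matD[OF spectral_decompD(1)[OF dec A]]
  define w where "w = mat_adjoint U *\<^sub>v v"
  have w: "w \<in> carrier_vec n" using U v by (simp add: w_def)
  have "A *\<^sub>v v = U *\<^sub>v (?D *\<^sub>v w)"
    unfolding w_def using U v
    by (subst spectral_decompD(2)[OF dec A])
       (simp add: assoc_mult_mat_vec[of _ n n _ n] mult_carrier_mat[of _ n n _ n])
  then have "(A *\<^sub>v v) \<bullet>c v = (?D *\<^sub>v w) \<bullet>c w"
    using cscalar_mult_mat_vec[OF U(1), of "?D *\<^sub>v w" v] v w
    by (simp add: w_def mult_mat_vec_carrier[of _ n n])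
  also have "\<dots> = (\<Sum>i<n. complex_of_real (d i) * (w $ i * cnj (w $ i)))"
    using w unfolding mat_diag_mult_vec[OF w]
    by (simp add: scalar_prod_def atLeast0LessThan mult.assoc)
  also have "\<dots> = (\<Sum>i<n. complex_of_real (d i * weight U v i))"
    by (simp add: mult_cnj_cmod weight_def w_def[symmetric])
  finally show ?thesis by simp
qed

lemma cscalar_unitary:
  assumes U: "unitary_mat n U" and v: "v \<in> carrier_vec n" and w: "w \<in> carrier_vec n"
  shows "(mat_adjoint U *\<^sub>v v) \<bullet>c (mat_adjoint U *\<^sub>v w) = v \<bullet>c w"
proof -
  note u = unitary_matD[OF U]
  have "(mat_adjoint U *\<^sub>v v) \<bullet>c (mat_adjoint U *\<^sub>v w) = (U *\<^sub>v (mat_adjoint U *\<^sub>v v)) \<bullet>c w"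
    using cscalar_mult_mat_vec[OF u(1), of "mat_adjoint U *\<^sub>v v" w] u v w by simp
  also have "U *\<^sub>v (mat_adjoint U *\<^sub>v v) = v"
    using u v by (simp flip: assoc_mult_mat_vec[of _ n n _ n])
  finally show ?thesis .
qed

text \<open>Parseval's identity. As the total mass is the same for every unitary basis, eigenvalues
  can be shifted by a constant, and the top coefficient of the numerator \<open>N\<close> below
  cancels.\<close>

lemma sum_weight:
  assumes U: "unitary_mat n U" and v: "v \<in> carrier_vec n"
  shows "(\<Sum>i<n. weight U v i) = (\<Sum>i<n. (cmod (v $ i))\<^sup>2)"
proof -
  have sq: "w \<bullet>c w = complex_of_real (\<Sum>i<n. (cmod (w $ i))\<^sup>2)" if "w \<in> carrier_vec n" for w
    using that by (simp add: scalar_prod_def atLeast0LessThan mult_cnj_cmod)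
  have "complex_of_real (\<Sum>i<n. weight U v i) = complex_of_real (\<Sum>i<n. (cmod (v $ i))\<^sup>2)"
    using cscalar_unitary[OF U v v] sq[OF v] sq[of "mat_adjoint U *\<^sub>v v"] unitary_matD[OF U] v
    by (simp add: weight_def)
  then show ?thesis by (simp only: of_real_eq_iff)
qed

lemma hermitian_spectral:
  assumes "spectral_decomp A U d" "A \<in> carrier_mat n n"
  shows "hermitian_mat n A"
proof -
  note U = unitary_matD[OF spectral_decompD(1)[OF assms]]
  let ?D = "mat_diag n (\<lambda>i. complex_of_real (d i))"
  have "mat_adjoint (U * ?D * mat_adjoint U) = U * (?D * mat_adjoint U)"
    by (simp add: mat_adjoint_mult mat_adjoint_diag_real carrier_matD[OF U(1)] carrier_matD[OF mat_diag_dim])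
  also have "\<dots> = U * ?D * mat_adjoint U"
    using U by (intro assoc_mult_mat[symmetric]) auto
  finally show ?thesis
    using spectral_decompD(2)[OF assms] assms(2) by (simp add: hermitian_mat_def)
qed

lemma mat_fun_spectral:
  assumes "spectral_decomp A U d" "A \<in> carrier_mat n n"
  shows "spectral_decomp (mat_fun f A) U (\<lambda>i. f (d i))" "mat_fun f A \<in> carrier_mat n n"
  using spectral_decompI[OF spectral_decompD(1)[OF assms], of "mat_fun f A" "\<lambda>i. f (d i)"]
    mat_fun_eq[OF assms(1), of f] assms(2)
  by auto

text \<open>Quadratic forms are diagonal in the eigenbases. This is applied both to
  \<open>A\<close>, \<open>B\<close> and to their images under \<open>f\<close>, which have the same
  eigenbases and hence the same weights.\<close>

lemma loewner_le_iff:
  assumes A: "spectral_decomp A U d" "A \<in> carrier_mat n n" and B: "spectral_decomp B V e" "B \<in> carrier_mat n n"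
  shows "loewner_le n A B \<longleftrightarrow>
    (\<forall>v\<in>carrier_vec n. (\<Sum>i<n. d i * weight U v i) \<le> (\<Sum>i<n. e i * weight V v i))"
proof -
  have "mat_adjoint (B - A) = B - A"
    using hermitian_spectral[OF A] hermitian_spectral[OF B] A(2) B(2)
    unfolding hermitian_mat_def
    by (intro eq_matI) (auto simp: mat_adjoint_index, metis carrier_matD complex_cnj_diff mat_adjoint_index conjugate_complex_def)
  moreover have "((B - A) *\<^sub>v v) \<bullet>c v =
    complex_of_real ((\<Sum>i<n. e i * weight V v i) - (\<Sum>i<n. d i * weight U v i))"
    if v: "v \<in> carrier_vec n" for v
  proof -
    have "((B - A) *\<^sub>v v) \<bullet>c v = (B *\<^sub>v v) \<bullet>c v - (A *\<^sub>v v) \<bullet>c v"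
      using A(2) B(2) v minus_scalar_prod_distrib[of "B *\<^sub>v v" n "A *\<^sub>v v" "conjugate v"]
      by (simp add: minus_mult_distrib_mat_vec)
    then show ?thesis
      using quadratic_form_spectral[OF A v] quadratic_form_spectral[OF B v] by simp
  qed
  ultimately have "psd_mat n (B - A) \<longleftrightarrow>
    (\<forall>v\<in>carrier_vec n. (\<Sum>i<n. d i * weight U v i) \<le> (\<Sum>i<n. e i * weight V v i))"
    using minus_carrier_mat[OF A(2), of B]
    by (simp add: psd_mat_def hermitian_mat_def less_eq_complex_def)
  then show ?thesis
    using A(2) B(2) unfolding loewner_le_def by simp
qed

text \<open>Similar matrices have the same characteristic polynomial, and that of a diagonal matrix
  is visibly split.\<close>

lemma spectrum_spectral:
  assumes "spectral_decomp A U d" "A \<in> carrier_mat n n"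
  shows "spectrum A = (\<lambda>i. complex_of_real (d i)) ` {..<n}"
proof -
  let ?D = "mat_diag n (\<lambda>i. complex_of_real (d i))"
  note U = unitary_matD[OF spectral_decompD(1)[OF assms]]
  have "similar_mat A ?D"
    using U assms(2) spectral_decompD(2)[OF assms] by (intro similar_matI[where n = n]) auto
  then have "char_poly A = char_poly ?D" by (rule char_poly_similar)
  also have "\<dots> = (\<Prod>a\<leftarrow>diag_mat ?D. [:- a, 1:])"
    by (rule char_poly_upper_triangular[of _ n]) (auto simp: mat_diag_def)
  also have "diag_mat ?D = map (\<lambda>i. complex_of_real (d i)) [0..<n]"
    by (auto simp: diag_mat_def mat_diag_def)
  finally have cp: "char_poly A = (\<Prod>a\<leftarrow>map (\<lambda>i. complex_of_real (d i)) [0..<n]. [:- a, 1:])" .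
  show ?thesis
    unfolding spectrum_root_char_poly[OF assms(2)] cp
    by (auto simp: poly_prod_list prod_list_zero_iff)
qed

text \<open>For the two quadratic forms \<open>X \<ge> Y > 0\<close> and \<open>w = X\<inverse> v\<close> one has \<open>\<langle>X\<inverse> v, v\<rangle> = \<langle>w, v\<rangle> = \<langle>X w, w\<rangle>\<close>; combine this with
  \<open>2 Re \<langle>w, v\<rangle> \<le> \<langle>Y w, w\<rangle> + \<langle>Y\<inverse> v, v\<rangle>\<close>.\<close>

lemma sum_weight_div_mono:
  assumes U: "unitary_mat n U" and V: "unitary_mat n V"
    and r: "\<And>i. i < n \<Longrightarrow> 0 < r i" and p: "\<And>i. i < n \<Longrightarrow> 0 < p i"
    and le: "\<And>w. w \<in> carrier_vec n \<Longrightarrow> (\<Sum>i<n. p i * weight V w i) \<le> (\<Sum>i<n. r i * weight U w i)"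
    and v: "v \<in> carrier_vec n"
  shows "(\<Sum>i<n. weight U v i / r i) \<le> (\<Sum>i<n. weight V v i / p i)"
proof -
  note u = unitary_matD[OF U] and v' = unitary_matD[OF V]
  \<comment> \<open>The coordinates of \<open>X\<inverse> v\<close> in the eigenbasis
    \<open>U\<close> of \<open>X\<close>, where \<open>r\<close> lists the eigenvalues of
    \<open>X\<close> and \<open>p\<close> those of \<open>Y\<close>.\<close>
  define x where "x = vec n (\<lambda>i. (mat_adjoint U *\<^sub>v v) $ i / of_real (r i))"
  define w where "w = U *\<^sub>v x"
  define R where "R = (\<Sum>i<n. weight U v i / r i)"
  have x: "x \<in> carrier_vec n" and w: "w \<in> carrier_vec n"
    using u by (auto simp: x_def w_def)
  have Uw: "mat_adjoint U *\<^sub>v w = x"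
    unfolding w_def using u x by (simp flip: assoc_mult_mat_vec[of _ n n _ n])
  have "r i * weight U w i = weight U v i / r i" if "i < n" for i
    unfolding weight_def Uw using r[OF that] that
    by (simp add: x_def norm_divide power2_eq_square)
  then have quad: "(\<Sum>i<n. r i * weight U w i) = R" by (simp add: R_def)
  have "w \<bullet>c v = x \<bullet>c (mat_adjoint U *\<^sub>v v)"
    using cscalar_unitary[OF U w v] Uw by simp
  also have "\<dots> = (\<Sum>i<n. (mat_adjoint U *\<^sub>v v) $ i * cnj ((mat_adjoint U *\<^sub>v v) $ i) / of_real (r i))"
    using u v unfolding x_def scalar_prod_def by (simp add: atLeast0LessThan del: index_mult_mat_vec)
  also have "\<dots> = (\<Sum>i<n. of_real (weight U v i / r i))"
    by (simp only: mult_cnj_cmod weight_def of_real_divide of_real_power)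
  finally have "w \<bullet>c v = of_real R" by (simp add: R_def)
  moreover have "w \<bullet>c v = (mat_adjoint V *\<^sub>v w) \<bullet>c (mat_adjoint V *\<^sub>v v)"
    using cscalar_unitary[OF V w v] by simp
  ultimately have "of_real R =
    (\<Sum>i<n. (mat_adjoint V *\<^sub>v w) $ i * cnj ((mat_adjoint V *\<^sub>v v) $ i))"
    using v' v w unfolding scalar_prod_def by (simp add: atLeast0LessThan del: index_mult_mat_vec)
  then have "Re (of_real R) = Re (\<Sum>i<n. (mat_adjoint V *\<^sub>v w) $ i * cnj ((mat_adjoint V *\<^sub>v v) $ i))"
    by (rule arg_cong)
  then have "2 * R = (\<Sum>i<n. 2 * Re ((mat_adjoint V *\<^sub>v w) $ i * cnj ((mat_adjoint V *\<^sub>v v) $ i)))"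
    by (simp only: Re_sum sum_distrib_left Re_complex_of_real)
  also have "\<dots> \<le> (\<Sum>i<n. p i * weight V w i + weight V v i / p i)"
  proof (rule sum_mono)
    fix i assume "i \<in> {..<n}"
    then have p0: "0 < p i" using p by simp
    let ?a = "(mat_adjoint V *\<^sub>v w) $ i" and ?b = "(mat_adjoint V *\<^sub>v v) $ i"
    have "Re (?a * cnj ?b) \<le> cmod ?a * cmod ?b"
      using complex_Re_le_cmod[of "?a * cnj ?b"] by (simp add: norm_mult)
    \<comment> \<open>Completing the square bounds the mixed product by the two weighted
      squares.\<close>
    moreover have "0 \<le> (p i * cmod ?a - cmod ?b)\<^sup>2 / p i" using p0 by simp
    moreover have "(p i * cmod ?a - cmod ?b)\<^sup>2 / p i = p i * (cmod ?a)\<^sup>2 + (cmod ?b)\<^sup>2 / p i - 2 * (cmod ?a * cmod ?b)"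
      using p0 by (simp add: field_simps power2_eq_square)
    ultimately show "2 * Re (?a * cnj ?b) \<le> p i * weight V w i + weight V v i / p i"
      unfolding weight_def by linarith
  qed
  also have "\<dots> = (\<Sum>i<n. p i * weight V w i) + (\<Sum>i<n. weight V v i / p i)"
    by (simp add: sum.distrib)
  also have "\<dots> \<le> R + (\<Sum>i<n. weight V v i / p i)"
    using le[OF w] quad by simp
  finally show ?thesis by (simp add: R_def)
qed

section \<open>The spectral theorem for Hermitian matrices\<close>

lemma unitary_completion:
  assumes v: "v \<in> carrier_vec n" and v0: "v \<noteq> 0\<^sub>v n"
  obtains W c where "unitary_mat n W" "col W 0 = c \<cdot>\<^sub>v v"
proof -
  interpret cof_vec_space n "TYPE(complex)" .
  have n: "n \<noteq> 0" using v v0 by (cases n) auto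
  define b where "b = basis_completion v"
  define ws where "ws = gram_schmidt n b"
  have b: "distinct b" "\<not> lin_dep (set b)" "set b \<subseteq> carrier_vec n" "hd b = v" "length b = n"
    using basis_completion[OF v v0, folded b_def] by auto
  then obtain vs where bv: "b = v # vs" using n by (cases b) auto
  have ws: "set ws \<subseteq> carrier_vec n" "corthogonal ws" "length ws = n"
    using gram_schmidt_result[OF b(3,1,2) refl, folded ws_def] b(5) by auto
  \<comment> \<open>Gram-Schmidt keeps the first vector, so after normalization the first column is
    still a multiple of \<open>v\<close>.\<close>
  have "hd ws = v" unfolding ws_def bv using gram_schmidt_hd[OF v] .
  then have ws0: "ws ! 0 = v" using ws(3) n by (cases ws) auto
  have wsc: "ws ! i \<in> carrier_vec n" if "i < n" for i using ws that by auto
  define c where "c = (\<lambda>i. complex_of_real (1 / sqrt (Re (ws ! i \<bullet>c ws ! i))))"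
  define W where "W = mat_of_cols n (map (\<lambda>i. c i \<cdot>\<^sub>v ws ! i) [0..<n])"
  have W: "W \<in> carrier_mat n n" unfolding W_def using mat_of_cols_carrier(1)[of n "map (\<lambda>i. c i \<cdot>\<^sub>v ws ! i) [0..<n]"] by simp
  have colW: "col W i = c i \<cdot>\<^sub>v ws ! i" if "i < n" for i
    unfolding W_def using that wsc[OF that] by (subst col_mat_of_cols) auto
  have one: "c i * cnj (c i) * (ws ! i \<bullet>c ws ! i) = 1" if i: "i < n" for i
  proof -
    have pos: "ws ! i \<bullet>c ws ! i > 0"
      using corthogonalD[OF ws(2), of i i] conjugate_square_greater_0_vec[OF wsc[OF i]]
        conjugate_square_eq_0_vec[OF wsc[OF i]] i ws(3) by auto
    then obtain r where r: "ws ! i \<bullet>c ws ! i = complex_of_real r" "0 < r"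
      by (metis complex_is_Real_iff less_complex_def of_real_Re zero_complex.sel(1) zero_complex.sel(2))
    have "complex_of_real (1 / sqrt r * (1 / sqrt r) * r) = 1"
      using r(2) by simp
    then show ?thesis using r by (simp add: c_def del: of_real_mult flip: of_real_mult)
  qed
  have "mat_adjoint W * W = 1\<^sub>m n"
  proof (rule eq_matI)
    fix i j assume "i < dim_row (1\<^sub>m n :: complex mat)" "j < dim_col (1\<^sub>m n :: complex mat)"
    then have i: "i < n" and j: "j < n" by auto
    have "(mat_adjoint W * W) $$ (i, j) = col W j \<bullet>c col W i"
      using i j W by (simp add: scalar_prod_def mat_adjoint_index mult.commute)
    also have "\<dots> = c j * cnj (c i) * (ws ! j \<bullet>c ws ! i)"
      unfolding colW[OF i] colW[OF j] using wsc[OF i] wsc[OF j]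
      by (simp add: scalar_prod_def sum_distrib_left mult_ac)
    also have "\<dots> = 1\<^sub>m n $$ (i, j)"
    proof (cases "i = j")
      case True
      then show ?thesis using one[OF i] i by simp
    next
      case False
      then show ?thesis using corthogonalD[OF ws(2), of j i] i j ws(3) by simp
    qed
    finally show "(mat_adjoint W * W) $$ (i, j) = 1\<^sub>m n $$ (i, j)" .
  qed (use W in auto)
  then have "unitary_mat n W" using W by (intro unitary_matI)
  then show ?thesis using that colW[of 0] n ws0 by simp
qed

lemma four_block_diag_adjoint:
  fixes U :: "complex mat"
  assumes "U \<in> carrier_mat n n"
  shows "mat_adjoint (four_block_mat (1\<^sub>m 1) (0\<^sub>m 1 n) (0\<^sub>m n 1) U) =
    four_block_mat (1\<^sub>m 1) (0\<^sub>m 1 n) (0\<^sub>m n 1) (mat_adjoint U)"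
  using assms by (intro eq_matI) (auto simp: mat_adjoint_index)

lemma four_block_diag_mult:
  fixes A B :: "complex mat"
  assumes "A \<in> carrier_mat n n" "B \<in> carrier_mat n n" "a \<in> carrier_mat 1 1" "b \<in> carrier_mat 1 1"
  shows "four_block_mat a (0\<^sub>m 1 n) (0\<^sub>m n 1) A * four_block_mat b (0\<^sub>m 1 n) (0\<^sub>m n 1) B =
    four_block_mat (a * b) (0\<^sub>m 1 n) (0\<^sub>m n 1) (A * B)"
  using assms by (subst mult_four_block_mat[of _ 1 1 _ n _ n _ _ 1 _ n]) auto

lemma mult_mat_unit_vec:
  fixes A :: "complex mat"
  assumes "A \<in> carrier_mat m n" "i < n"
  shows "A *\<^sub>v unit_vec n i = col A i"
  using assms by (intro eq_vecI) (auto simp: scalar_prod_right_unit)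

text \<open>Deflation: in a unitary basis that starts with an eigenvector, the first column is a
  multiple of the first unit vector, and by symmetry so is the first row. The remaining block is
  Hermitian of size \<open>n\<close>.\<close>

lemma hermitian_spectral_decomp:
  assumes "hermitian_mat n A"
  shows "\<exists>U d. spectral_decomp A U d"
  using assms
proof (induction n arbitrary: A)
  case 0
  then have "A = 1\<^sub>m 0 * mat_diag 0 (\<lambda>i. complex_of_real 0) * mat_adjoint (1\<^sub>m 0)"
    by (intro eq_matI) (auto simp: hermitian_mat_def)
  moreover have "unitary_mat 0 (1\<^sub>m 0)" by (simp add: unitary_mat_def)
  ultimately have "spectral_decomp A (1\<^sub>m 0) (\<lambda>i. 0)" by (rule spectral_decompI(1)[rotated])
  then show ?case by blast
next
  case (Suc n)
  let ?N = "Suc n"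
  have A: "A \<in> carrier_mat ?N ?N" and herm: "mat_adjoint A = A"
    using Suc.prems by (auto simp: hermitian_mat_def)
  obtain e where "e \<in> spectrum A" using spectrum_non_empty[OF A] by auto
  then obtain v where v: "v \<in> carrier_vec ?N" "v \<noteq> 0\<^sub>v ?N" "A *\<^sub>v v = e \<cdot>\<^sub>v v"
    using A by (auto simp: spectrum_def eigenvalue_def eigenvector_def)
  obtain W c where W: "unitary_mat ?N W" and col: "col W 0 = c \<cdot>\<^sub>v v"
    using unitary_completion[OF v(1,2)] by metis
  note w = unitary_matD[OF W]
  define B where "B = mat_adjoint W * A * W"
  have B: "B \<in> carrier_mat ?N ?N" using w A by (simp add: B_def)
  have "mat_adjoint B = mat_adjoint W * (A * W)"
    unfolding B_def using w A herm by (simp add: mat_adjoint_mult)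
  also have "\<dots> = B" unfolding B_def using w A by (intro assoc_mult_mat[symmetric])
  finally have hermB: "mat_adjoint B = B" .
  have B_sym: "B $$ (i, j) = cnj (B $$ (j, i))" if "i < ?N" "j < ?N" for i j
    using mat_adjoint_index[of i B j] B that hermB by simp
  have cw: "col W 0 \<in> carrier_vec ?N" using w(1) by (intro col_carrier_vec) auto
  have "col B 0 = B *\<^sub>v unit_vec ?N 0" using mult_mat_unit_vec[OF B] by simp
  also have "\<dots> = mat_adjoint W *\<^sub>v (A *\<^sub>v col W 0)"
    unfolding B_def using w A mult_mat_unit_vec[OF w(1), of 0]
    by (simp add: assoc_mult_mat_vec[of _ ?N ?N _ ?N] mult_carrier_mat[of _ ?N ?N _ ?N])
  also have "A *\<^sub>v col W 0 = e \<cdot>\<^sub>v col W 0"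
    unfolding col using A v by (simp add: mult_mat_vec smult_smult_assoc mult.commute)
  also have "mat_adjoint W *\<^sub>v (e \<cdot>\<^sub>v col W 0) = e \<cdot>\<^sub>v (mat_adjoint W *\<^sub>v (W *\<^sub>v unit_vec ?N 0))"
    using mult_mat_vec[OF w(2) cw] mult_mat_unit_vec[OF w(1), of 0] by (simp only:)
  also have "mat_adjoint W *\<^sub>v (W *\<^sub>v unit_vec ?N 0) = unit_vec ?N 0"
    using assoc_mult_mat_vec[OF w(2,1), of "unit_vec ?N 0"] w(4) by simp
  finally have col_B: "col B 0 = e \<cdot>\<^sub>v unit_vec ?N 0" .
  have B0: "B $$ (i, 0) = (if i = 0 then e else 0)" if "i < ?N" for i
  proof -
    have "B $$ (i, 0) = col B 0 $ i" using that B by simp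
    then show ?thesis unfolding col_B using that by simp
  qed
  \<comment> \<open>The eigenvalue is a diagonal entry of a Hermitian matrix, hence real.\<close>
  have "e = cnj e" using B_sym[of 0 0] B0[of 0] by (metis zero_less_Suc)
  from arg_cong[OF this, of Im] have "Im e = 0" by simp
  then have e: "complex_of_real (Re e) = e" and cnj_e: "cnj e = e"
    by (simp_all add: complex_eq_iff)
  have B0': "B $$ (0, i) = (if i = 0 then e else 0)" if "i < ?N" for i
  proof -
    have "B $$ (0, i) = cnj (B $$ (i, 0))" using that by (intro B_sym) auto
    then show ?thesis unfolding B0[OF that] using cnj_e by simp
  qed
  define C where "C = mat n n (\<lambda>(i, j). B $$ (Suc i, Suc j))"
  have C: "C \<in> carrier_mat n n" by (simp add: C_def)
  have "mat_adjoint C = C"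
  proof (rule eq_matI)
    fix i j assume "i < dim_row C" "j < dim_col C"
    then show "mat_adjoint C $$ (i, j) = C $$ (i, j)"
      using B_sym[of "Suc i" "Suc j"] by (simp add: C_def mat_adjoint_index)
  qed (simp_all add: C_def)
  then have "hermitian_mat n C" using C by (simp add: hermitian_mat_def)
  then obtain U d where "spectral_decomp C U d" using Suc.IH by blast
  note UC = spectral_decompD[OF this C] and u = unitary_matD[OF spectral_decompD(1)[OF this C]]
  let ?f = "\<lambda>a X. four_block_mat a (0\<^sub>m 1 n) (0\<^sub>m n 1) X"
  \<comment> \<open>The eigenvalue split off gets index \<open>0\<close> and those of the block move
    up by one.\<close>
  let ?d = "case_nat (Re e) d"
  define Z where "Z = ?f (1\<^sub>m 1) U"
  have Z: "Z \<in> carrier_mat ?N ?N" 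
    using four_block_carrier_mat[of "1\<^sub>m 1" 1 1 U n n] u(1) by (simp add: Z_def)
  have "mat_adjoint Z * Z = ?f (1\<^sub>m 1) (1\<^sub>m n)"
    unfolding Z_def four_block_diag_adjoint[OF u(1)]
    by (subst four_block_diag_mult[OF u(2,1)]) (auto simp: u(4))
  also have "\<dots> = 1\<^sub>m ?N" by (intro eq_matI) auto
  finally have unitZ: "unitary_mat ?N Z" using Z by (intro unitary_matI)
  have "mat_diag ?N (\<lambda>i. complex_of_real (?d i)) =
    ?f (mat 1 1 (\<lambda>_. e)) (mat_diag n (\<lambda>i. complex_of_real (d i)))"
    using e by (intro eq_matI) (auto simp: mat_diag_def split: nat.splits)
  then have "Z * mat_diag ?N (\<lambda>i. complex_of_real (?d i)) * mat_adjoint Z =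
    ?f (1\<^sub>m 1 * mat 1 1 (\<lambda>_. e) * 1\<^sub>m 1) (U * mat_diag n (\<lambda>i. complex_of_real (d i)) * mat_adjoint U)"
    unfolding Z_def four_block_diag_adjoint[OF u(1)]
    using u(1,2)
    by (simp only: four_block_diag_mult mult_carrier_mat[of _ n n _ n] mult_carrier_mat[of _ 1 1 _ 1]
      mat_diag_dim mat_carrier one_carrier_mat)
  also have "\<dots> = ?f (mat 1 1 (\<lambda>_. e)) C"
    by (simp flip: UC(2))
  also have "\<dots> = B"
    using B B0 B0' by (intro eq_matI) (auto simp: C_def less_Suc_eq_0_disj)
  finally have BZ: "B = Z * mat_diag ?N (\<lambda>i. complex_of_real (?d i)) * mat_adjoint Z" by simp
  let ?D = "mat_diag ?N (\<lambda>i. complex_of_real (?d i))"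
  note [simp] = mult_carrier_mat[of _ ?N ?N _ ?N]
  note as = assoc_mult_mat[of _ ?N ?N _ ?N _ ?N]
  have zc: "mat_adjoint Z \<in> carrier_mat ?N ?N" using Z by (simp add: mat_adjoint_carrier)
  have "A = (W * mat_adjoint W) * A * (W * mat_adjoint W)" using w A by simp
  also have "\<dots> = W * B * mat_adjoint W"
    unfolding B_def using w(1,2) A by (simp add: as)
  also have "\<dots> = (W * Z) * ?D * mat_adjoint (W * Z)"
    unfolding BZ using w(1,2) Z zc by (simp add: as mat_adjoint_mult carrier_matD[OF Z] carrier_matD[OF w(1)])
  finally have "A = (W * Z) * ?D * mat_adjoint (W * Z)" .
  then have "spectral_decomp A (W * Z) ?d"
    by (rule spectral_decompI(1)[OF unitary_mat_mult[OF W unitZ]])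
  then show ?case by blast
qed

section \<open>Sufficiency\<close>

text \<open>Eigenvalues may be repeated, whereas the nodes of a divided difference are distinct; so
  the weights are collected by eigenvalue.\<close>

lemma sum_group_fibres:
  fixes d :: "nat \<Rightarrow> real" and a g :: "_ \<Rightarrow> real"
  assumes "finite S" "d ` {..<n} \<subseteq> S"
  shows "(\<Sum>s\<in>S. (\<Sum>i\<in>{i. i < n \<and> d i = s}. a i) * g s) = (\<Sum>i<n. a i * g (d i))"
proof -
  have "(\<Sum>i<n. a i * g (d i)) = (\<Sum>s\<in>S. \<Sum>i\<in>{i. i \<in> {..<n} \<and> d i = s}. a i * g (d i))"
    using assms by (intro sum.group[symmetric]) auto
  also have "\<dots> = (\<Sum>s\<in>S. (\<Sum>i\<in>{i. i < n \<and> d i = s}. a i) * g s)"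
    by (simp add: sum_distrib_right)
  finally show ?thesis by simp
qed

lemma n_monotone_if_dd_cond:
  assumes cond: "\<And>k. 1 \<le> k \<Longrightarrow> k \<le> n \<Longrightarrow> dd_cond F f k"
  shows "n_monotone_on n F f"
  unfolding n_monotone_on_def
proof (intro allI impI, elim conjE)
  fix A B
  assume hA: "hermitian_mat n A" and hB: "hermitian_mat n B" and sA: "spectrum A \<subseteq> complex_of_real ` F"
    and sB: "spectrum B \<subseteq> complex_of_real ` F" and AB: "loewner_le n A B"
  obtain U d where decA: "spectral_decomp A U d" using hermitian_spectral_decomp[OF hA] by blast
  obtain V e where decB: "spectral_decomp B V e" using hermitian_spectral_decomp[OF hB] by blast
  have cA: "A \<in> carrier_mat n n" and cB: "B \<in> carrier_mat n n"
    using hA hB by (auto simp: hermitian_mat_def)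
  note U = spectral_decompD(1)[OF decA cA] and V = spectral_decompD(1)[OF decB cB]
  have dF: "d ` {..<n} \<subseteq> F"
    using sA unfolding spectrum_spectral[OF decA cA] by auto
  have eF: "e ` {..<n} \<subseteq> F"
    using sB unfolding spectrum_spectral[OF decB cB] by auto
  have le: "(\<Sum>i<n. d i * weight U w i) \<le> (\<Sum>i<n. e i * weight V w i)" if "w \<in> carrier_vec n" for w
    using AB that loewner_le_iff[OF decA cA decB cB] by blast
  define S where "S = d ` {..<n} \<union> e ` {..<n}"
  have S: "finite S" "S \<subseteq> F" and dS: "d ` {..<n} \<subseteq> S" and eS: "e ` {..<n} \<subseteq> S"
    using dF eF by (auto simp: S_def)
  have "card S \<le> card (d ` {..<n}) + card (e ` {..<n})" unfolding S_def by (rule card_Un_le)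
  then have cardS: "card S \<le> 2 * n"
    using card_image_le[of "{..<n}" d] card_image_le[of "{..<n}" e] by simp
  have "(\<Sum>i<n. f (d i) * weight U v i) \<le> (\<Sum>i<n. f (e i) * weight V v i)"
    if v: "v \<in> carrier_vec n" for v
  proof -
    \<comment> \<open>A signed measure on \<open>S\<close>: the spectral measure of \<open>B\<close>
      in the direction \<open>v\<close> minus that of \<open>A\<close>.\<close>
    define l where "l = (\<lambda>s. (\<Sum>i\<in>{i. i < n \<and> e i = s}. weight V v i) - (\<Sum>i\<in>{i. i < n \<and> d i = s}. weight U v i))"
    have l: "(\<Sum>s\<in>S. l s * g s) = (\<Sum>i<n. weight V v i * g (e i)) - (\<Sum>i<n. weight U v i * g (d i))" for g
      unfolding l_def left_diff_distrib sum_subtractf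
        sum_group_fibres[OF S(1) dS] sum_group_fibres[OF S(1) eS] ..
    have eq_mass: "(\<Sum>i<n. weight V w i) = (\<Sum>i<n. weight U w i)" if "w \<in> carrier_vec n" for w
      using sum_weight[OF U that] sum_weight[OF V that] by simp
    have mass: "(\<Sum>s\<in>S. l s) = 0"
      using l[of "\<lambda>_. 1"] eq_mass[OF v] by simp
    (* N t / (PROD r:S. t - r) is the difference of the resolvents at t in the direction v. *)
    define N where "N = (\<Sum>s\<in>S. Polynomial.smult (l s) (\<Prod>r\<in>S - {s}. [:- r, 1:]))"
    have Ns: "poly N x = l x * (\<Prod>r\<in>S - {x}. x - r)" if x: "x \<in> S" for x
    proof -
      have z: "l s * (\<Prod>r\<in>S - {s}. x - r) = 0" if "s \<in> S - {x}" for s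
        using that x S(1) by auto
      have "poly N x = (\<Sum>s\<in>S. l s * (\<Prod>r\<in>S - {s}. x - r))" by (simp add: N_def poly_sum poly_prod)
      also have "\<dots> = l x * (\<Prod>r\<in>S - {x}. x - r) + (\<Sum>s\<in>S - {x}. l s * (\<Prod>r\<in>S - {s}. x - r))"
        using S x by (intro sum.remove) auto
      also have "(\<Sum>s\<in>S - {x}. l s * (\<Prod>r\<in>S - {s}. x - r)) = 0"
        by (rule sum.neutral) (rule ballI, rule z)
      finally show ?thesis by simp
    qed
    \<comment> \<open>The value of \<open>N\<close> at a node contains exactly the denominator of
      the divided difference there.\<close>
    have dd_N: "dd S (\<lambda>t. g t * poly N t) = (\<Sum>s\<in>S. l s * g s)" for g
      unfolding dd_def
    proof (rule sum.cong[OF refl])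
      fix s assume s: "s \<in> S"
      have "(\<Prod>r\<in>S - {s}. s - r) \<noteq> 0" using S(1) by auto
      then show "g s * poly N s / (\<Prod>r\<in>S - {s}. s - r) = l s * g s" using Ns[OF s] by simp
    qed
    have "(\<Sum>i<n. f (e i) * weight V v i) - (\<Sum>i<n. f (d i) * weight U v i) = dd S (\<lambda>t. f t * poly N t)"
      unfolding dd_N l by (simp add: mult.commute)
    moreover have "0 \<le> dd S (\<lambda>t. f t * poly N t)"
    \<comment> \<open>With at most one node the bound \<open>card S - 2\<close> would be truncated;
      there the divided difference is zero, as the total mass is.\<close>
    proof (cases "card S \<le> 1")
      case True
      show ?thesis
      proof (cases "S = {}")
        case False
        then have "card S = 1" using True S(1) card_gt_0_iff[of S] by linarith
        then obtain s where "S = {s}" by (rule card_1_singletonE)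
        then show ?thesis unfolding dd_N using mass by simp
      qed (simp add: dd_def)
    next
      case False
      have degN: "degree N < card S"
      proof -
        have "degree N \<le> card S - 1"
          unfolding N_def
        proof (rule degree_sum_le[OF S(1)])
          fix s assume s: "s \<in> S"
          have "degree (Polynomial.smult (l s) (\<Prod>r\<in>S - {s}. [:- r, 1:])) \<le> degree (\<Prod>r\<in>S - {s}. [:- r, 1:])"
            by (rule degree_smult_le)
          also have "\<dots> = card S - 1"
            using s S(1) by (subst degree_prod_eq_sum_degree) auto
          finally show "degree (Polynomial.smult (l s) (\<Prod>r\<in>S - {s}. [:- r, 1:])) \<le> card S - 1" .
        qed
        then show ?thesis using False by simp
      qed
      \<comment> \<open>The top coefficient is the total mass of \<open>l\<close>.\<close>
      have lc: "coeff N (card S - 1) = 0"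
        using dd_poly[OF S(1) degN] dd_N[of "\<lambda>_. 1"] mass by simp
      have "degree N \<noteq> card S - 1"
      proof
        assume eq: "degree N = card S - 1"
        then have "lead_coeff N = 0" using lc by simp
        then have "N = 0" by simp
        then show False using eq False by simp
      qed
      then have degN2: "degree N \<le> card S - 2"
        using degN by linarith
      have res: "poly N t = (\<Prod>r\<in>S. t - r) * ((\<Sum>i<n. weight V v i / (t - e i)) - (\<Sum>i<n. weight U v i / (t - d i)))"
        if t: "t \<notin> S" for t
      proof -
        have "poly N t = (\<Sum>s\<in>S. l s * (\<Prod>r\<in>S - {s}. t - r))" by (simp add: N_def poly_sum poly_prod)
        also have "\<dots> = (\<Sum>s\<in>S. (\<Prod>r\<in>S. t - r) * (l s * (1 / (t - s))))"
        proof (rule sum.cong[OF refl])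
          fix s assume s: "s \<in> S"
          have "(\<Prod>r\<in>S. t - r) = (t - s) * (\<Prod>r\<in>S - {s}. t - r)" using S s by (intro prod.remove)
          moreover have "t - s \<noteq> 0" using s t by auto
          ultimately show "l s * (\<Prod>r\<in>S - {s}. t - r) = (\<Prod>r\<in>S. t - r) * (l s * (1 / (t - s)))" by simp
        qed
        also have "\<dots> = (\<Prod>r\<in>S. t - r) * (\<Sum>s\<in>S. l s * (1 / (t - s)))" by (rule sum_distrib_left[symmetric])
        finally show ?thesis unfolding l by simp
      qed
      have "S \<noteq> {}" using False by auto
      have pos: "0 \<le> poly N t" if t: "Max S < t" for t
      proof -
        have tS: "r < t" if "r \<in> S" for r using S(1) that t by (meson Max_ge le_less_trans)
        \<comment> \<open>Here \<open>t - A \<ge> t - B > 0\<close>, and inversion reverses the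
          order.\<close>
        have "(\<Sum>i<n. weight U v i / (t - d i)) \<le> (\<Sum>i<n. weight V v i / (t - e i))"
        proof (rule sum_weight_div_mono[OF U V _ _ _ v])
          fix w :: "complex vec" assume w: "w \<in> carrier_vec n"
          show "(\<Sum>i<n. (t - e i) * weight V w i) \<le> (\<Sum>i<n. (t - d i) * weight U w i)"
            using le[OF w] eq_mass[OF w]
            by (simp add: left_diff_distrib sum_subtractf flip: sum_distrib_left)
        qed (use tS dS eS in auto)
        moreover have "0 \<le> (\<Prod>r\<in>S. t - r)" using tS by (intro prod_nonneg) (auto simp: less_imp_le)
        moreover have "t \<notin> S" using tS less_irrefl by blast
        ultimately show ?thesis by (simp add: res)
      qed
      have neg: "0 \<le> (-1) ^ (card S - 2) * poly N t" if t: "t < Min S" for t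
      proof -
        have tS: "t < r" if "r \<in> S" for r using S(1) that t by (meson Min_le less_le_trans)
        \<comment> \<open>To the left of \<open>S\<close> the positive matrices are
          \<open>B - t \<ge> A - t\<close>, so the roles of \<open>U\<close> and \<open>V\<close>
          are exchanged.\<close>
        have "(\<Sum>i<n. weight V v i / (e i - t)) \<le> (\<Sum>i<n. weight U v i / (d i - t))"
        proof (rule sum_weight_div_mono[OF V U _ _ _ v])
          fix w :: "complex vec" assume w: "w \<in> carrier_vec n"
          show "(\<Sum>i<n. (d i - t) * weight U w i) \<le> (\<Sum>i<n. (e i - t) * weight V w i)"
            using le[OF w] eq_mass[OF w]
            by (simp add: left_diff_distrib sum_subtractf flip: sum_distrib_left)
        qed (use tS dS eS in auto)
        moreover have "a / (x - t) = - (a / (t - x))" for a x :: real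
          by (simp add: minus_divide_right)
        ultimately have diff: "0 \<le> (\<Sum>i<n. weight V v i / (t - e i)) - (\<Sum>i<n. weight U v i / (t - d i))"
          by (simp add: sum_negf)
        \<comment> \<open>All \<open>card S\<close> factors are negative, and
          \<open>card S \<ge> 2\<close> has the parity of \<open>card S - 2\<close>.\<close>
        have sgn: "0 \<le> (-1) ^ (card S - 2) * (\<Prod>r\<in>S. t - r)"
        proof -
          have "(\<Prod>r\<in>S. t - r) = (\<Prod>r\<in>S. (-1) * (r - t))" by simp
          also have "\<dots> = (-1) ^ card S * (\<Prod>r\<in>S. r - t)" by (simp only: prod.distrib prod_constant)
          also have "card S = Suc (Suc (card S - 2))" using False by simp
          finally have "(-1) ^ (card S - 2) * (\<Prod>r\<in>S. t - r) = ((-1) ^ (card S - 2))\<^sup>2 * (\<Prod>r\<in>S. r - t)"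
            by (simp add: power2_eq_square)
          moreover have "0 \<le> (\<Prod>r\<in>S. r - t)" using tS by (intro prod_nonneg) (auto simp: less_imp_le)
          ultimately show ?thesis by simp
        qed
        have "t \<notin> S" using tS less_irrefl by blast
        then show ?thesis
          unfolding res[OF \<open>t \<notin> S\<close>] mult.assoc[symmetric] by (intro mult_nonneg_nonneg[OF sgn diff])
      qed
      have "Min S \<le> Max S" using S(1) \<open>S \<noteq> {}\<close> by simp
      then have "outer_cone (Min S) (Max S) (card S - 2) N"
        using degN2 pos neg by (intro outer_coneI) auto
      then show ?thesis
        using S False cardS by (intro outer_cone_dd_nonneg[where F = F] cond) auto
    qed
    ultimately show ?thesis by linarith
  qed
  then show "loewner_le n (mat_fun f A) (mat_fun f B)"
    using loewner_le_iff[OF mat_fun_spectral[OF decA cA, of f] mat_fun_spectral[OF decB cB, of f]] by simp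
qed

section \<open>Necessity\<close>

text \<open>The pattern \<open>a 0 < b 0 < a 1 < b 1 < ...\<close> of the eigenvalues before and
  after a positive rank one perturbation.\<close>

locale interlacing =
  fixes a b :: "nat \<Rightarrow> real" and k :: nat
  assumes a_less_b: "i < k \<Longrightarrow> a i < b i"
    and b_less_a: "i < j \<Longrightarrow> j < k \<Longrightarrow> b i < a j"
begin

lemma a_mono: "i < j \<Longrightarrow> j < k \<Longrightarrow> a i < a j"
  using a_less_b[of i] b_less_a[of i j] by simp

lemma b_mono: "i < j \<Longrightarrow> j < k \<Longrightarrow> b i < b j"
  using a_less_b[of j] b_less_a[of i j] by simp

lemma inj_a: "inj_on a {..<k}"
  by (intro inj_onI) (metis a_mono lessThan_iff less_irrefl linorder_neqE_nat)

lemma inj_b: "inj_on b {..<k}"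
  by (intro inj_onI) (metis b_mono lessThan_iff less_irrefl linorder_neqE_nat)

lemma a_neq_b: "i < k \<Longrightarrow> j < k \<Longrightarrow> a i \<noteq> b j"
  using a_less_b[of i] a_less_b[of j] b_less_a[of i j] b_less_a[of j i]
  by (cases i j rule: linorder_cases) auto

lemma b_neq_a: "i < k \<Longrightarrow> j < k \<Longrightarrow> b j \<noteq> a i"
  using a_neq_b[of i j] by simp

text \<open>\<open>Pa\<close> and \<open>Pb\<close> are the derivatives of the node polynomials of
  \<open>a\<close> and \<open>b\<close> at their own roots; \<open>Pab\<close> and
  \<open>Pba\<close> are the values of each polynomial at the roots of the other.\<close>

definition Pa :: "nat \<Rightarrow> real" where "Pa i = (\<Prod>l\<in>{..<k} - {i}. a i - a l)"
definition Pb :: "nat \<Rightarrow> real" where "Pb j = (\<Prod>l\<in>{..<k} - {j}. b j - b l)"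
definition Pab :: "nat \<Rightarrow> real" where "Pab i = (\<Prod>j<k. a i - b j)"
definition Pba :: "nat \<Rightarrow> real" where "Pba j = (\<Prod>i<k. b j - a i)"
text \<open>\<open>diag a\<close> plus the rank one matrix \<open>w w\<^sup>T\<close> has the eigenvalues \<open>b j\<close>, with orthonormal eigenvectors
  \<open>i \<mapsto> w i * z j / (b j - a i)\<close>: the residues of \<open>\<Prod>(t - b j) / \<Prod>(t - a i)\<close> and of its inverse
  determine \<open>w\<close> and \<open>z\<close>.\<close>

definition w :: "nat \<Rightarrow> real" where "w i = sqrt (- Pab i / Pa i)"
definition z :: "nat \<Rightarrow> real" where "z j = sqrt (Pba j / Pb j)"

lemma Pa_nonzero: "i < k \<Longrightarrow> Pa i \<noteq> 0"
  using inj_a by (auto simp: Pa_def inj_on_def)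

lemma Pb_nonzero: "j < k \<Longrightarrow> Pb j \<noteq> 0"
  using inj_b by (auto simp: Pb_def inj_on_def)

lemma Pba_nonzero: "j < k \<Longrightarrow> Pba j \<noteq> 0"
  using a_neq_b by (force simp: Pba_def)

text \<open>For \<open>l \<noteq> i\<close> the points \<open>a l\<close> and \<open>b l\<close> lie
  on the same side of \<open>a i\<close>, so pairing the factors gives positive quotients; the
  unpaired factor takes the minus sign.\<close>

lemma w_sq_pos: assumes i: "i < k" shows "0 < - Pab i / Pa i"
proof -
  have "Pab i = (a i - b i) * (\<Prod>l\<in>{..<k} - {i}. a i - b l)"
    unfolding Pab_def using i by (intro prod.remove) auto
  then have "- Pab i = (b i - a i) * (\<Prod>l\<in>{..<k} - {i}. a i - b l)"
    by (simp add: algebra_simps)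
  then have "- Pab i / Pa i = (b i - a i) * (\<Prod>l\<in>{..<k} - {i}. (a i - b l) / (a i - a l))"
    by (simp only: Pa_def prod_dividef times_divide_eq_right)
  also have "\<dots> > 0"
  proof (intro mult_pos_pos prod_pos)
    show "0 < b i - a i" using a_less_b[OF i] by simp
    fix l assume l: "l \<in> {..<k} - {i}"
    then consider "l < i" | "i < l" by fastforce
    then show "0 < (a i - b l) / (a i - a l)"
    proof cases
      case 1
      then show ?thesis using b_less_a[OF 1 i] a_mono[OF 1 i] by simp
    next
      case 2
      then show ?thesis using a_mono[OF 2] a_less_b[of l] l by (intro divide_neg_neg) auto
    qed
  qed
  finally show ?thesis .
qed

text \<open>The same pairing: for \<open>l \<noteq> j\<close> the points \<open>a l\<close> and
  \<open>b l\<close> lie on the same side of \<open>b j\<close>.\<close>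

lemma z_sq_pos: assumes j: "j < k" shows "0 < Pba j / Pb j"
proof -
  have "Pba j = (b j - a j) * (\<Prod>l\<in>{..<k} - {j}. b j - a l)"
    unfolding Pba_def using j by (intro prod.remove) auto
  then have "Pba j / Pb j = (b j - a j) * (\<Prod>l\<in>{..<k} - {j}. (b j - a l) / (b j - b l))"
    by (simp add: Pb_def prod_dividef)
  also have "\<dots> > 0"
  proof (intro mult_pos_pos prod_pos)
    show "0 < b j - a j" using a_less_b[OF j] by simp
    fix l assume l: "l \<in> {..<k} - {j}"
    then consider "l < j" | "j < l" by fastforce
    then show "0 < (b j - a l) / (b j - b l)"
    proof cases
      case 1
      then show ?thesis using b_mono[OF 1 j] a_less_b[of l] l by simp
    next
      case 2
      then show ?thesis using b_less_a[OF 2] b_mono[OF 2] l by (intro divide_neg_neg) auto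
    qed
  qed
  finally show ?thesis .
qed

lemma w_sq: "i < k \<Longrightarrow> w i * w i = - Pab i / Pa i"
  unfolding w_def by (simp only: real_sqrt_mult_self abs_of_pos[OF w_sq_pos])

lemma z_sq: "j < k \<Longrightarrow> z j * z j = Pba j / Pb j"
  unfolding z_def by (simp only: real_sqrt_mult_self abs_of_pos[OF z_sq_pos])

lemma w_pos: "i < k \<Longrightarrow> 0 < w i"
  using w_sq_pos[of i] unfolding w_def by simp

lemma sum_poly_over_Pa:
  assumes "degree p < k"
  shows "(\<Sum>i<k. poly p (a i) / Pa i) = coeff p (k - 1)"
proof -
  have "dd (a ` {..<k}) (poly p) = coeff p (k - 1)"
    using dd_poly[of "a ` {..<k}" p] assms inj_a by (simp add: card_image)
  then show ?thesis unfolding dd_image[OF inj_a] Pa_def .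
qed

text \<open>The degree is too small for a nonzero divided difference at the \<open>k + 1\<close>
  nodes \<open>a i\<close> and \<open>b j\<close>; solve for the term at \<open>b j\<close>.\<close>

lemma partial_fractions:
  assumes "degree p < k" and j: "j < k"
  shows "(\<Sum>i<k. poly p (a i) / ((b j - a i) * Pa i)) = poly p (b j) / Pba j"
proof -
  have disj: "a ` {..<k} \<inter> {b j} = {}" using b_neq_a j by auto
  have "0 = dd (a ` {..<k} \<union> {b j}) (poly p)"
    using assms inj_a disj by (subst dd_poly_eq_0) (auto simp: card_image)
  also have "\<dots> = (\<Sum>s\<in>a ` {..<k}. poly p s / ((\<Prod>r\<in>a ` {..<k} - {s}. s - r) * (s - b j))) +
      poly p (b j) / (\<Prod>r\<in>a ` {..<k}. b j - r)"
    using disj by (subst dd_Un_disjoint) auto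
  also have "(\<Prod>r\<in>a ` {..<k}. b j - r) = Pba j"
    using inj_a by (simp add: Pba_def prod.reindex)
  also have "(\<Sum>s\<in>a ` {..<k}. poly p s / ((\<Prod>r\<in>a ` {..<k} - {s}. s - r) * (s - b j))) =
      dd (a ` {..<k}) (\<lambda>s. poly p s / (s - b j))"
    unfolding dd_def by (simp add: mult.commute)
  also have "\<dots> = (\<Sum>i<k. poly p (a i) / ((a i - b j) * Pa i))"
    unfolding dd_image[OF inj_a] Pa_def by simp
  also have "\<dots> = - (\<Sum>i<k. poly p (a i) / ((b j - a i) * Pa i))"
    unfolding sum_negf[symmetric]
  proof (rule sum.cong[OF refl])
    fix i
    have "(a i - b j) * Pa i = - ((b j - a i) * Pa i)" by (simp add: algebra_simps)
    then show "poly p (a i) / ((a i - b j) * Pa i) = - (poly p (a i) / ((b j - a i) * Pa i))"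
      by (simp only: divide_minus_right)
  qed
  finally show ?thesis by simp
qed

text \<open>The node polynomial of \<open>b\<close> without its root \<open>b j\<close>. Writing
  \<open>w i\<close> through it cancels the denominators \<open>b j - a i\<close> in the sums
  below.\<close>

definition Nb :: "nat \<Rightarrow> real poly" where "Nb j = (\<Prod>l\<in>{..<k} - {j}. [:- b l, 1:])"

lemma Nb:
  assumes j: "j < k"
  shows "degree (Nb j) < k" "coeff (Nb j) (k - 1) = 1"
proof -
  have deg: "degree (Nb j) = k - 1"
    unfolding Nb_def using j by (subst degree_prod_eq_sum_degree) auto
  then show "degree (Nb j) < k" using j by simp
  have "lead_coeff (Nb j) = 1" unfolding Nb_def by (simp add: lead_coeff_prod)
  then show "coeff (Nb j) (k - 1) = 1" using deg by simp
qed

lemma w_sq_Nb: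
  assumes "i < k" "j < k"
  shows "w i * w i = (b j - a i) * poly (Nb j) (a i) / Pa i"
proof -
  have "Pab i = (a i - b j) * (\<Prod>l\<in>{..<k} - {j}. a i - b l)"
    unfolding Pab_def using assms by (intro prod.remove) auto
  also have "(\<Prod>l\<in>{..<k} - {j}. a i - b l) = poly (Nb j) (a i)"
    by (simp add: Nb_def poly_prod)
  finally have "- Pab i = (b j - a i) * poly (Nb j) (a i)" by (simp add: algebra_simps)
  then show ?thesis using assms by (simp only: w_sq)
qed

text \<open>The secular equation, which makes \<open>b j\<close> an eigenvalue of the perturbed
  matrix. The sum reduces to the leading coefficient of the monic \<open>Nb j\<close>.\<close>

lemma sum_w:
  assumes j: "j < k"
  shows "(\<Sum>i<k. w i * w i / (b j - a i)) = 1"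
proof -
  have "(\<Sum>i<k. w i * w i / (b j - a i)) = (\<Sum>i<k. poly (Nb j) (a i) / Pa i)"
    using j b_neq_a[OF _ j] by (intro sum.cong) (auto simp: w_sq_Nb[OF _ j])
  then show ?thesis using sum_poly_over_Pa[OF Nb(1)[OF j]] Nb(2)[OF j] by simp
qed

text \<open>Orthonormality of the eigenvectors. Partial fractions turn the sum into the value of
  \<open>Nb j\<close> at \<open>b l\<close>, which vanishes unless \<open>j = l\<close>; then
  \<open>z j\<close> normalizes it.\<close>

lemma sum_w_pair:
  assumes j: "j < k" and l: "l < k"
  shows "z j * z l * (\<Sum>i<k. w i * w i / ((b j - a i) * (b l - a i))) = (if j = l then 1 else 0)"
proof -
  have "(\<Sum>i<k. w i * w i / ((b j - a i) * (b l - a i))) = (\<Sum>i<k. poly (Nb j) (a i) / ((b l - a i) * Pa i))"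
    using j b_neq_a[OF _ j] by (intro sum.cong) (auto simp: w_sq_Nb[OF _ j])
  also have "\<dots> = poly (Nb j) (b l) / Pba l" using partial_fractions[OF Nb(1)[OF j] l] .
  finally have eq: "(\<Sum>i<k. w i * w i / ((b j - a i) * (b l - a i))) = poly (Nb j) (b l) / Pba l" .
  show ?thesis
  proof (cases "j = l")
    case True
    have "poly (Nb j) (b j) = Pb j" by (simp add: Nb_def Pb_def poly_prod)
    then show ?thesis using True eq z_sq[OF j] Pb_nonzero[OF j] Pba_nonzero[OF j] by simp
  next
    case False
    then have "poly (Nb j) (b l) = 0" using l by (auto simp: Nb_def poly_prod)
    then show ?thesis using False eq by simp
  qed
qed

end

section \<open>Matrices with interlacing spectra\<close>

context interlacing
begin

text \<open>The construction lives in size \<open>k\<close> and is padded to size \<open>n\<close>: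
  \<open>A\<close> and \<open>B\<close> agree on the extra block, where \<open>U\<close> is the
  identity. The padding eigenvalue \<open>a 0\<close> is one of the given points and so adds nothing
  outside \<open>F\<close>.\<close>

lemma exists_rank_one_step:
  assumes k: "1 \<le> k" "k \<le> n"
  defines "da \<equiv> \<lambda>i. if i < k then a i else a 0" and "db \<equiv> \<lambda>i. if i < k then b i else a 0"
  obtains A B U where
    "spectral_decomp A (1\<^sub>m n) da" "A \<in> carrier_mat n n" "spectral_decomp B U db" "B \<in> carrier_mat n n"
    "loewner_le n A B"
    "U = mat n n (\<lambda>(i, j). complex_of_real (if i < k \<and> j < k then w i * z j / (b j - a i) else if i = j then 1 else 0))"
proof -
  define u where "u = (\<lambda>i j. if i < k \<and> j < k then w i * z j / (b j - a i) else if i = j then 1 else 0)"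
  define w' where "w' = (\<lambda>i. if i < k then w i else 0)"
  define U where "U = mat n n (\<lambda>(i, j). complex_of_real (u i j))"
  define A where "A = mat_diag n (\<lambda>i. complex_of_real (da i))"
  define R where "R = mat n n (\<lambda>(i, j). complex_of_real (w' i * w' j))"
  define D where "D = mat_diag n (\<lambda>i. complex_of_real (db i))"
  have U: "U \<in> carrier_mat n n" and A: "A \<in> carrier_mat n n" and R: "R \<in> carrier_mat n n" and D: "D \<in> carrier_mat n n"
    by (auto simp: U_def A_def R_def D_def)
  have split: "(\<Sum>i<n. g i) = (\<Sum>i<k. g i) + (\<Sum>i\<in>{k..<n}. g i)" for g :: "nat \<Rightarrow> real"
    using k by (subst sum.union_disjoint[symmetric]) (auto intro!: sum.cong)
  have orth: "(\<Sum>i<n. u i j * u i l) = (if j = l then 1 else 0)" if "j < n" "l < n" for j l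
  proof -
    have tail: "(\<Sum>i\<in>{k..<n}. u i j * u i l) = (if j = l \<and> k \<le> j then 1 else 0)"
    proof -
      have "(\<Sum>i\<in>{k..<n}. u i j * u i l) = (\<Sum>i\<in>{k..<n}. if i = j then (if j = l then 1 else 0) else 0)"
        by (rule sum.cong) (auto simp: u_def)
      then show ?thesis using that by auto
    qed
    consider "j < k" "l < k" | "k \<le> j \<or> k \<le> l" by linarith
    then show ?thesis
    proof cases
      case 1
      have "(\<Sum>i<k. u i j * u i l) = z j * z l * (\<Sum>i<k. w i * w i / ((b j - a i) * (b l - a i)))"
        unfolding sum_distrib_left using 1 by (intro sum.cong) (auto simp: u_def)
      then show ?thesis using sum_w_pair[OF 1] tail 1 unfolding split by simp
    next
      case 2
      then have "(\<Sum>i<k. u i j * u i l) = 0"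
        by (intro sum.neutral) (auto simp: u_def)
      then show ?thesis using 2 tail unfolding split by auto
    qed
  qed
  have "mat_adjoint U * U = 1\<^sub>m n"
  proof (rule eq_matI)
    fix i j assume "i < dim_row (1\<^sub>m n :: complex mat)" "j < dim_col (1\<^sub>m n :: complex mat)"
    then have ij: "i < n" "j < n" by auto
    have "(mat_adjoint U * U) $$ (i, j) = complex_of_real (\<Sum>l<n. u l i * u l j)"
      using ij U by (simp add: scalar_prod_def mat_adjoint_index atLeast0LessThan) (simp add: U_def)
    then show "(mat_adjoint U * U) $$ (i, j) = 1\<^sub>m n $$ (i, j)"
      using orth[OF ij] ij by simp
  qed (use U in auto)
  then have unit: "unitary_mat n U" using U by (intro unitary_matI)
  note u' = unitary_matD[OF unit]
  \<comment> \<open>Column \<open>j\<close> of \<open>U\<close> is an eigenvector of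
    \<open>A + R\<close>: by the secular equation its inner product with \<open>w'\<close> is
    \<open>z j\<close> when \<open>j < k\<close>.\<close>
  have eig: "da i * u i j + w' i * (\<Sum>l<n. w' l * u l j) = u i j * db j" if "i < n" "j < n" for i j
  proof -
    have "(\<Sum>l\<in>{k..<n}. w' l * u l j) = 0" by (intro sum.neutral) (auto simp: w'_def)
    then have eq: "(\<Sum>l<n. w' l * u l j) = (\<Sum>l<k. w l * u l j)" unfolding split by (simp add: w'_def)
    show ?thesis
    proof (cases "i < k \<and> j < k")
      case True
      then have "(\<Sum>l<k. w l * u l j) = z j * (\<Sum>l<k. w l * w l / (b j - a l))"
        unfolding sum_distrib_left by (intro sum.cong) (auto simp: u_def)
      then have "(\<Sum>l<n. w' l * u l j) = z j" using sum_w[of j] True eq by simp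
      moreover have "b j - a i \<noteq> 0" using b_neq_a[of i j] True by simp
      ultimately show ?thesis using True by (simp add: u_def w'_def da_def db_def field_simps)
    next
      case False
      have "w' i * (\<Sum>l<k. w l * u l j) = 0"
      proof (cases "i < k")
        case True
        then have "\<not> j < k" using False by simp
        then have "(\<Sum>l<k. w l * u l j) = 0" by (intro sum.neutral) (auto simp: u_def)
        then show ?thesis by simp
      qed (simp add: w'_def)
      then show ?thesis using False eq by (auto simp: u_def da_def db_def)
    qed
  qed
  have AR: "A + R \<in> carrier_mat n n" using A R by simp
  have "(A + R) * U = U * D"
  proof (rule eq_matI)
    fix i j assume "i < dim_row (U * D)" "j < dim_col (U * D)"
    then have ij: "i < n" "j < n" using U D by auto
    have "((A + R) * U) $$ (i, j) = (A * U) $$ (i, j) + (R * U) $$ (i, j)"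
      using A R U ij by (simp add: add_mult_distrib_mat[OF A R U])
    also have "(A * U) $$ (i, j) = complex_of_real (da i * u i j)"
      unfolding A_def mat_diag_mult_left[OF U] using ij by (simp add: U_def)
    also have "(R * U) $$ (i, j) = complex_of_real (w' i * (\<Sum>l<n. w' l * u l j))"
      using ij by (simp add: R_def U_def scalar_prod_def atLeast0LessThan sum_distrib_left mult.assoc)
    also have "complex_of_real (da i * u i j) + \<dots> = complex_of_real (u i j * db j)"
      using eig[OF ij] by (simp only: flip: of_real_add)
    also have "\<dots> = (U * D) $$ (i, j)"
      unfolding D_def mat_diag_mult_right[OF U] using ij by (simp add: U_def)
    finally show "((A + R) * U) $$ (i, j) = (U * D) $$ (i, j)" .
  qed (use A R U D in auto)
  then have "(A + R) * (U * mat_adjoint U) = U * D * mat_adjoint U"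
    using assoc_mult_mat[OF AR u'(1,2)] by simp
  then have B: "A + R = U * D * mat_adjoint U"
    unfolding u'(3) right_mult_one_mat[OF AR] .
  have one: "unitary_mat n (1\<^sub>m n)" by (simp add: unitary_mat_def)
  have "A = 1\<^sub>m n * mat_diag n (\<lambda>i. complex_of_real (da i)) * mat_adjoint (1\<^sub>m n)"
    unfolding A_def mat_adjoint_one left_mult_one_mat[OF mat_diag_dim] right_mult_one_mat[OF mat_diag_dim] ..
  then have decA: "spectral_decomp A (1\<^sub>m n) da" by (rule spectral_decompI(1)[OF one])
  have decB: "spectral_decomp (A + R) U db"
    by (rule spectral_decompI(1)[OF unit B[unfolded D_def]])
  have "psd_mat n R"
    unfolding psd_mat_def hermitian_mat_def
  proof (intro conjI ballI)
    show "mat_adjoint R = R"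
      using R by (intro eq_matI) (auto simp: mat_adjoint_index R_def mult.commute)
    fix v :: "complex vec" assume v: "v \<in> carrier_vec n"
    define s where "s = (\<Sum>j<n. complex_of_real (w' j) * v $ j)"
    have "(R *\<^sub>v v) \<bullet>c v = (\<Sum>i<n. complex_of_real (w' i) * s * cnj (v $ i))"
      using v by (simp add: R_def s_def scalar_prod_def atLeast0LessThan sum_distrib_left mult.assoc)
    \<comment> \<open>The form of a rank one matrix is a squared modulus.\<close>
    also have "\<dots> = s * cnj s"
      by (simp add: s_def sum_distrib_left mult_ac)
    also have "\<dots> = complex_of_real ((cmod s)\<^sup>2)" by (simp add: mult_cnj_cmod)
    finally show "0 \<le> (R *\<^sub>v v) \<bullet>c v" by (simp add: less_eq_complex_def)
  qed (rule R)
  moreover have "A + R - A = R"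
    using A R by (intro eq_matI) auto
  ultimately have "loewner_le n A (A + R)"
    using A AR by (simp add: loewner_le_def)
  then show ?thesis
    using that[OF decA A decB AR] by (simp add: U_def u_def)
qed

lemma dd_square_nonneg:
  assumes k: "1 \<le> k" "k \<le> n" and mono: "n_monotone_on n F f"
    and F: "a ` {..<k} \<subseteq> F" "b ` {..<k} \<subseteq> F" and q: "degree q < k"
  shows "0 \<le> dd (a ` {..<k} \<union> b ` {..<k}) (\<lambda>t. f t * (poly q t)\<^sup>2)"
proof -
  define da where "da = (\<lambda>i. if i < k then a i else a 0)"
  define db where "db = (\<lambda>i. if i < k then b i else a 0)"
  obtain A B U where decA: "spectral_decomp A (1\<^sub>m n) da" and A: "A \<in> carrier_mat n n"
    and decB: "spectral_decomp B U db" and B: "B \<in> carrier_mat n n" and AB: "loewner_le n A B"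
    and U: "U = mat n n (\<lambda>(i, j). complex_of_real (if i < k \<and> j < k then w i * z j / (b j - a i) else if i = j then 1 else 0))"
    by (rule exists_rank_one_step[OF k, folded da_def db_def]) (rule that)
  have "da ` {..<n} \<subseteq> F" "db ` {..<n} \<subseteq> F"
    using F k by (auto simp: da_def db_def)
  then have "spectrum A \<subseteq> complex_of_real ` F" "spectrum B \<subseteq> complex_of_real ` F"
    unfolding spectrum_spectral[OF decA A] spectrum_spectral[OF decB B] by auto
  then have le: "loewner_le n (mat_fun f A) (mat_fun f B)"
    using mono hermitian_spectral[OF decA A] hermitian_spectral[OF decB B] AB
    unfolding n_monotone_on_def by blast
  \<comment> \<open>Chosen so that its squares are, up to sign, the coefficients of the divided
    difference at the nodes \<open>a i\<close>. By partial fractions its coordinate at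
    \<open>b j\<close> is \<open>z j * poly q (b j) / Pba j\<close>, whose square is the coefficient
    at \<open>b j\<close>.\<close>
  define v where "v = (\<lambda>i. if i < k then poly q (a i) / (w i * Pa i) else 0)"
  define cv where "cv = vec n (\<lambda>i. complex_of_real (v i))"
  have cv: "cv \<in> carrier_vec n" by (simp add: cv_def)
  have splitk: "(\<Sum>i<n. g i) = (\<Sum>i<k. g i)" if "\<And>i. k \<le> i \<Longrightarrow> i < n \<Longrightarrow> g i = 0" for g :: "nat \<Rightarrow> real"
    using that k by (intro sum.mono_neutral_right) auto
  have wA: "weight (1\<^sub>m n) cv i = (v i)\<^sup>2" if "i < n" for i
    using that by (simp add: weight_def cv_def)
  have wB: "weight U cv j = (if j < k then (poly q (b j))\<^sup>2 / (Pb j * Pba j) else 0)" if j: "j < n" for j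
  proof -
    let ?u = "\<lambda>i j. if i < k \<and> j < k then w i * z j / (b j - a i) else if i = j then 1 else 0"
    have "(mat_adjoint U *\<^sub>v cv) $ j = complex_of_real (\<Sum>i<n. ?u i j * v i)"
      using j unfolding U cv_def
      by (simp add: scalar_prod_def mat_adjoint_index atLeast0LessThan)
    also have "(\<Sum>i<n. ?u i j * v i) = (\<Sum>i<k. ?u i j * v i)"
      by (rule splitk) (simp add: v_def)
    also have "\<dots> = (if j < k then z j * (poly q (b j) / Pba j) else 0)"
    proof (cases "j < k")
      case True
      have "(\<Sum>i<k. ?u i j * v i) = z j * (\<Sum>i<k. poly q (a i) / ((b j - a i) * Pa i))"
        unfolding sum_distrib_left
      proof (rule sum.cong[OF refl])
        fix i assume "i \<in> {..<k}"
        then show "?u i j * v i = z j * (poly q (a i) / ((b j - a i) * Pa i))"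
          using True w_pos[of i] by (simp add: v_def)
      qed
      then show ?thesis unfolding partial_fractions[OF q True] using True by simp
    qed (auto intro!: sum.neutral)
    finally have "weight U cv j = (if j < k then z j * (poly q (b j) / Pba j) else 0)\<^sup>2"
      unfolding weight_def by simp
    also have "\<dots> = (if j < k then (z j * z j) * ((poly q (b j))\<^sup>2 / (Pba j * Pba j)) else 0)"
      by (simp add: power2_eq_square)
    also have "\<dots> = (if j < k then (poly q (b j))\<^sup>2 / (Pb j * Pba j) else 0)"
      using Pba_nonzero[of j] by (simp add: z_sq)
    finally show ?thesis .
  qed
  have "(\<Sum>i<n. f (da i) * weight (1\<^sub>m n) cv i) \<le> (\<Sum>i<n. f (db i) * weight U cv i)"
    using le cv loewner_le_iff[OF mat_fun_spectral[OF decA A, of f] mat_fun_spectral[OF decB B, of f]]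
    by blast
  also have "(\<Sum>i<n. f (da i) * weight (1\<^sub>m n) cv i) = (\<Sum>i<k. f (da i) * weight (1\<^sub>m n) cv i)"
    by (rule splitk) (simp add: wA v_def)
  also have "\<dots> = - (\<Sum>i<k. f (a i) * (poly q (a i))\<^sup>2 / (Pa i * Pab i))"
    unfolding sum_negf[symmetric]
  proof (rule sum.cong[OF refl])
    fix i assume "i \<in> {..<k}"
    then have i: "i < k" by simp
    have "Pab i \<noteq> 0" using w_sq_pos[OF i] by auto
    have "(v i)\<^sup>2 = (poly q (a i))\<^sup>2 / ((w i * w i) * (Pa i * Pa i))"
      using i by (simp add: v_def power2_eq_square)
    also have "\<dots> = - ((poly q (a i))\<^sup>2 / (Pa i * Pab i))"
      unfolding w_sq[OF i] using Pa_nonzero[OF i] \<open>Pab i \<noteq> 0\<close> by (simp add: field_simps)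
    finally show "f (da i) * weight (1\<^sub>m n) cv i = - (f (a i) * (poly q (a i))\<^sup>2 / (Pa i * Pab i))"
      using i k by (simp add: wA da_def)
  qed
  also have "(\<Sum>i<n. f (db i) * weight U cv i) = (\<Sum>i<k. f (db i) * weight U cv i)"
    by (rule splitk) (simp add: wB)
  also have "\<dots> = (\<Sum>i<k. f (b i) * (poly q (b i))\<^sup>2 / (Pb i * Pba i))"
    using k by (intro sum.cong) (auto simp: wB db_def)
  finally have main: "0 \<le> (\<Sum>i<k. f (a i) * (poly q (a i))\<^sup>2 / (Pa i * Pab i)) +
    (\<Sum>i<k. f (b i) * (poly q (b i))\<^sup>2 / (Pb i * Pba i))" by simp
  have disj: "a ` {..<k} \<inter> b ` {..<k} = {}" using a_neq_b by auto
  have img: "(\<Prod>r\<in>x ` {..<k} - {x i}. x i - r) = (\<Prod>l\<in>{..<k} - {i}. x i - x l)"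
    if "inj_on x {..<k}" "i < k" for x :: "nat \<Rightarrow> real" and i
  proof -
    have "x ` {..<k} - {x i} = x ` ({..<k} - {i})"
      using that by (auto simp: inj_on_def)
    then show ?thesis using that by (simp add: prod.reindex inj_on_diff)
  qed
  have "dd (a ` {..<k} \<union> b ` {..<k}) g =
    (\<Sum>i<k. g (a i) / (Pa i * Pab i)) + (\<Sum>i<k. g (b i) / (Pb i * Pba i))" for g
    unfolding dd_Un_disjoint[OF finite_imageI finite_imageI disj, OF finite_lessThan finite_lessThan]
      Pa_def Pab_def Pb_def Pba_def
    using inj_a inj_b by (simp add: sum.reindex prod.reindex img)
  then show ?thesis using main by simp
qed

end

lemma dd_cond_if_n_monotone:
  assumes mono: "n_monotone_on n F f" and k: "1 \<le> k" "k \<le> n"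
  shows "dd_cond F f k"
proof (rule dd_condI)
  fix X and q :: "real poly"
  assume X: "X \<subseteq> F" "finite X" "card X = 2 * k" and q: "degree q \<le> k - 1"
  define y where "y = (\<lambda>i. sorted_list_of_set X ! i)"
  have y_mono: "y i < y j" if "i < j" "j < 2 * k" for i j
    using that X sorted_wrt_nth_less[OF strict_sorted_list_of_set[of X]] by (simp add: y_def)
  have y_img: "y ` {..<2 * k} = X"
    using X nth_image[of "2 * k" "sorted_list_of_set X"] by (simp add: y_def atLeast0LessThan)
  \<comment> \<open>Counting from zero, even positions give the spectrum of the smaller matrix, so
    the least node is an \<open>a\<close> and the greatest a \<open>b\<close>.\<close>
  define a where "a = (\<lambda>i. y (2 * i))"
  define b where "b = (\<lambda>i. y (2 * i + 1))"
  interpret interlacing a b k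
    by unfold_locales (auto simp: a_def b_def intro!: y_mono)
  have "{..<2 * k} = (\<lambda>i. 2 * i) ` {..<k} \<union> (\<lambda>i. 2 * i + 1) ` {..<k}"
  proof (intro equalityI subsetI)
    fix i assume "i \<in> {..<2 * k}"
    then show "i \<in> (\<lambda>i. 2 * i) ` {..<k} \<union> (\<lambda>i. 2 * i + 1) ` {..<k}"
      by (cases "even i") (auto elim!: evenE oddE)
  qed auto
  then have XU: "X = a ` {..<k} \<union> b ` {..<k}"
    unfolding y_img[symmetric] a_def b_def by (simp only: image_Un image_image)
  show "0 \<le> dd X (\<lambda>t. f t * (poly q t)\<^sup>2)"
    unfolding XU using X(1) XU k q by (intro dd_square_nonneg[OF k mono]) auto
qed

theorem theorem1p7:
  fixes F :: "real set" and n :: nat and f :: "real \<Rightarrow> real"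
  assumes "n \<ge> 1"
  shows "(n_monotone_on n F f \<longleftrightarrow>
           (\<forall>k x. \<forall>q :: real poly. 1 \<le> k \<and> k \<le> n \<and>
              inj_on x {..2 * k - 1} \<and> x ` {..2 * k - 1} \<subseteq> F \<and> degree q \<le> k - 1 \<longrightarrow>
              divided_diff x (2 * k - 1) (\<lambda>t. f t * (poly q t)\<^sup>2) \<ge> 0))
       \<and> (infinite F \<or> card F > 2 * n \<longrightarrow>
           (n_monotone_on n F f \<longleftrightarrow>
             (\<forall>x. \<forall>q :: real poly.
                inj_on x {..2 * n - 1} \<and> x ` {..2 * n - 1} \<subseteq> F \<and> degree q \<le> n - 1 \<longrightarrow>
                divided_diff x (2 * n - 1) (\<lambda>t. f t * (poly q t)\<^sup>2) \<ge> 0)))"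
proof -
  have all: "n_monotone_on n F f \<longleftrightarrow> (\<forall>k. 1 \<le> k \<and> k \<le> n \<longrightarrow> dd_cond F f k)"
    using n_monotone_if_dd_cond dd_cond_if_n_monotone by blast
  have "dd_cond F f k" if F: "infinite F \<or> card F > 2 * n" and n: "dd_cond F f n" and k: "1 \<le> k" "k \<le> n" for k
    using k(2)
  proof (induction rule: inc_induct)
    case base
    show ?case by (rule n)
  next
    \<comment> \<open>Descent from \<open>m + 1\<close> to \<open>m\<close>: since
      \<open>m < n\<close>, having more than \<open>2 * n\<close> points provides the
      \<open>2 * m + 3\<close> that are required.\<close>
    case (step m)
    show ?case
      by (rule dd_cond_descend[OF step.IH]) (use F k step.hyps in auto)
  qed
  then have "infinite F \<or> card F > 2 * n \<Longrightarrow> n_monotone_on n F f \<longleftrightarrow> dd_cond F f n"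
    unfolding all using assms by blast
  with all show ?thesis
    using assms by (auto simp: dd_cond_iff)
qed

end
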